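(* There exists an absolute constant $c>0$ such that the following holds. Let $p,r,s\geq 3$ be integers and let $A\subset \mathbb{Z}^3$ be a finite set. Suppose that $A$ consists of at least $p$ planar slices, each in turn consisting of at least $r$ rows of size at least $s$; that is, for some fixed distinct $i,j\in\{1,2,3\}$: at least $p$ of the planar slices of $A$ orthogonal to the $i$-th coordinate axis are non-empty; every such non-empty planar slice has at least $r$ non-empty rows in direction $j$; and every non-empty row of $A$ in direction $j$ has at least $s$ elements. Let $k$ be an integer with $k\geq 62 \log r\, \log s\, \log p$. If $B\subset \mathbb{Z}$ is Freiman isomorphic of degree $k$ to $A$, then $$ \| F_B \|_1 \geq c \left(\frac{\log s\,\log r\,\log p}{\log\log s\, \log\log r \,\log\log p} \right)^{1/2}.$$
   Context: For a finite set $B\subset\mathbb{Z}$, the exponential sum of $B$ is $F_B(x)=\sum_{b\in B} e(b x)$ for $x\in\mathbb{T}=\mathbb{R}/\mathbb{Z}$, where $e(t)=\exp(2\pi i t)$, and $\|F_B\|_1=\int_{\mathbb{T}}|F_B(x)|\,dx$. The logarithm is the natural logarithm. For $A\subseteq\mathbb{Z}^3$: given $i\in\{1,2,3\}$ and $a_i\in\mathbb{Z}$, the intersection of $A$ with the plane $\{(x_1,x_2,x_3)\in\mathbb{Z}^3 : x_i=a_i\}$ is a planar slice of $A$ (orthogonal to the $i$-th coordinate axis). Given $j\in\{1,2,3\}$ and integers $a_l$ for $l\in\{1,2,3\}\setminus\{j\}$, the intersection of $A$ with the line $\{(x_1,x_2,x_3)\in\mathbb{Z}^3 : x_l=a_l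 \text{ for } l\in\{1,2,3\}\setminus\{j\}\}$ is a row of $A$ (in direction $j$). Let $A$ and $B$ be sets in two additive (abelian) groups and $k$ a positive integer. A map $\theta:A\to B$ is a Freiman isomorphism of degree $k$ if it is a bijection and, for any choice of $a_1,\dots,a_{2k}\in A$, the equality $a_1+\dots+a_k=a_{k+1}+\dots+a_{2k}$ holds if and only if $\theta(a_1)+\dots+\theta(a_k)=\theta(a_{k+1})+\dots+\theta(a_{2k})$ holds. If such a map exists, $A$ and $B$ are said to be Freiman isomorphic of degree $k$. *)

theory Defs
  imports "HOL-Analysis.Analysis"
begin

definition unit_exp :: "real \<Rightarrow> complex"
  where "unit_exp t = exp (2 * of_real pi * \<i> * of_real t)"

definition exp_sum :: "int set \<Rightarrow> real \<Rightarrow> complex"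
  where "exp_sum B x = (\<Sum>b\<in>B. unit_exp (of_int b * x))"

text \<open>For finite \<open>B\<close> the exponential sum is \<open>1\<close>-periodic, so the integral over
  \<open>\<real>/\<int>\<close> is taken over the unit interval.\<close>

definition L1_norm_exp_sum :: "int set \<Rightarrow> real"
  where "L1_norm_exp_sum B = (LINT x:{0..1}|lborel. cmod (exp_sum B x))"

text \<open>Points of \<open>\<int>\<^sup>3\<close> are vectors of type \<open>int ^ 3\<close>, and coordinate axes are indexed by the
  three-element type \<open>3\<close>. Both families below contain the empty set when some plane or line
  misses \<open>A\<close>. Non-empty slices (rows) along distinct parallel planes (lines) are distinct sets,
  so counting non-empty members of a family counts planes (lines) that meet \<open>A\<close>.\<close>

definition planar_slices :: "(int ^ 3) set \<Rightarrow> 3 \<Rightarrow> (int ^ 3) set set"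
  where "planar_slices A i = {A \<inter> {x. x $ i = a} |a :: int. True}"

text \<open>The value of the parameter \<open>a\<close> at the direction \<open>j\<close> is irrelevant.\<close>

definition axis_rows :: "(int ^ 3) set \<Rightarrow> 3 \<Rightarrow> (int ^ 3) set set"
  where "axis_rows A j = {A \<inter> {x. \<forall>l. l \<noteq> j \<longrightarrow> x $ l = a l} |a :: 3 \<Rightarrow> int. True}"

definition freiman_iso ::
    "nat \<Rightarrow> ('a::ab_group_add \<Rightarrow> 'b::ab_group_add) \<Rightarrow> 'a set \<Rightarrow> 'b set \<Rightarrow> bool"
  where "freiman_iso k \<theta> A B \<longleftrightarrow>
    bij_betw \<theta> A B \<and>
    (\<forall>a :: nat \<Rightarrow> 'a. (\<forall>m\<in>{1..2*k}. a m \<in> A) \<longrightarrow>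
      ((\<Sum>m=1..k. a m) = (\<Sum>m=k+1..2*k. a m) \<longleftrightarrow>
       (\<Sum>m=1..k. \<theta> (a m)) = (\<Sum>m=k+1..2*k. \<theta> (a m))))"

definition freiman_isomorphic :: "nat \<Rightarrow> 'a::ab_group_add set \<Rightarrow> 'b::ab_group_add set \<Rightarrow> bool"
  where "freiman_isomorphic k A B \<longleftrightarrow> (\<exists>\<theta>. freiman_iso k \<theta> A B)"

end

(*
The method of Cohen, Davenport and Pichorides, iterated once per coordinate. Let phi be bounded
by 1 and let z_1, ..., z_m be bounded by 1, with Z their sum and W = sum_{i<j} z_i cnj(z_j).
With V = 1/m + 2 W / m^2 one has |V| <= 1 and Re V >= |Z / m|^2, so the factor 1 - V/4 + V^2/16
leaves room for a small multiple of Z: phi (1 - eta) (1 - V/4 + V^2/16) + kappa Z is again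
bounded by 1 when kappa = sqrt(eta) / (2 m). Only differences y_i - y_j with i < j occur in W,
and a decreasing choice of the y_i avoiding few exceptional points makes all shifted frequencies
miss the spectrum. Hence N steps with m = N and eta = 1 / (2 N) multiply the pairing with F_B by
sqrt(N) / 12, and N can be taken of order log s / log log s when s positions are available.
The z_i need not be exponentials: the functions produced for the rows serve as the z_i within a
plane, and those of the planes serve as the z_i for the whole set. Every frequency that occurs is
a sum of n + 1 points minus a sum of n points with n < k, so the Freiman isomorphism decides in
Z^3 which of them lie in B, while the pointwise bounds hold whatever the frequencies are.
*)

theory Submission
  imports Defs
begin

subsection \<open>Trigonometric polynomials and their pairing with the exponential sum\<close>

definition wave :: "int \<Rightarrow> real \<Rightarrow> complex"
  where "wave n x = unit_exp (of_int n * x)"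

lemma wave_add: "wave (m + n) x = wave m x * wave n x"
  by (simp add: wave_def unit_exp_def distrib_left distrib_right exp_add)

lemma cnj_wave: "cnj (wave n x) = wave (- n) x"
  by (simp add: wave_def unit_exp_def exp_cnj)

lemma wave_0 [simp]: "wave 0 x = 1"
  by (simp add: wave_def unit_exp_def)

lemma norm_wave [simp]: "cmod (wave n x) = 1"
  by (simp add: wave_def unit_exp_def)

lemma continuous_on_wave [continuous_intros]: "continuous_on S (wave n)"
  unfolding wave_def unit_exp_def by (intro continuous_intros)

lemma exp_sum_wave: "exp_sum B x = (\<Sum>b\<in>B. wave b x)"
  by (simp add: exp_sum_def wave_def)

lemma continuous_on_exp_sum [continuous_intros]: "continuous_on S (exp_sum B)"
  unfolding exp_sum_wave[abs_def] by (intro continuous_intros)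

lemma integral_wave: "(LINT x:{0..1}|lborel. wave n x) = (if n = 0 then 1 else 0)"
proof (cases "n = 0")
  case True
  then show ?thesis by (simp add: set_lebesgue_integral_def)
next
  case False
  define w where "w = 2 * of_real pi * \<i> * of_int n"
  have w: "w \<noteq> 0" using False by (simp add: w_def)
  have wv: "wave n x = exp (w * of_real x)" for x
    by (simp add: wave_def unit_exp_def w_def mult.assoc)
  have "((\<lambda>x. exp (w * of_real x)) has_integral (exp (w * of_real 1) / w - exp (w * of_real 0) / w)) {0..1}"
    by (rule fundamental_theorem_of_calculus)
       (auto intro!: derivative_eq_intros has_vector_derivative_real_field simp: w)
  moreover have "exp (w * of_real 1) = 1"
    using exp_eq_1[of w] by (auto simp: w_def)
  ultimately have "(wave n has_integral 0) {0..1}"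
    by (simp add: wv[abs_def])
  moreover have "set_integrable lborel {0..1} (wave n)"
    by (intro borel_integrable_atLeastAtMost' continuous_intros)
  ultimately show ?thesis
    using False by (simp add: set_borel_integral_eq_integral(2) integral_unique)
qed

text \<open>A frequency is a pair whose second component is the integer actually occurring in the
  exponential; the first component records the corresponding point on the other side of the
  Freiman isomorphism.\<close>

inductive trig :: "('g \<times> int) set \<Rightarrow> (real \<Rightarrow> complex) \<Rightarrow> bool" for P where
  zero: "trig P (\<lambda>x. 0)"
| wave: "g \<in> P \<Longrightarrow> trig P (\<lambda>x. of_real c * wave (snd g) x)"
| add: "trig P f \<Longrightarrow> trig P f' \<Longrightarrow> trig P (\<lambda>x. f x + f' x)"

lemma trig_mono: "trig P f \<Longrightarrow> P \<subseteq> P' \<Longrightarrow> trig P' f"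
  by (induction rule: trig.induct) (auto intro: trig.intros)

lemma trig_single: "g \<in> P \<Longrightarrow> trig P (wave (snd g))"
  using trig.wave[of g P 1] by simp

lemma trig_scale: "trig P f \<Longrightarrow> trig P (\<lambda>x. of_real c * f x)"
proof (induction rule: trig.induct)
  case (wave g d)
  then show ?case using trig.wave[of g P "c * d"] by (simp add: mult.assoc)
qed (auto simp: distrib_left intro: trig.intros)

lemma trig_sum: "(\<And>i. i \<in> I \<Longrightarrow> trig P (f i)) \<Longrightarrow> trig P (\<lambda>x. \<Sum>i\<in>I. f i x)"
  by (induction I rule: infinite_finite_induct) (auto intro: trig.intros)

lemma trig_cnj:
  fixes P Q :: "('g::ab_group_add \<times> int) set"
  assumes "trig P f" "\<And>g. g \<in> P \<Longrightarrow> - g \<in> Q"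
  shows "trig Q (\<lambda>x. cnj (f x))"
  using assms(1)
proof (induction rule: trig.induct)
  case (wave g c)
  then show ?case using trig.wave[of "- g" Q c] assms(2) by (simp add: cnj_wave)
qed (auto intro: trig.intros)

lemma trig_mult:
  fixes P Q R :: "('g::ab_group_add \<times> int) set"
  assumes "trig P f" "trig Q f'" "\<And>g h. g \<in> P \<Longrightarrow> h \<in> Q \<Longrightarrow> g + h \<in> R"
  shows "trig R (\<lambda>x. f x * f' x)"
  using assms(1)
proof (induction rule: trig.induct)
  case (wave g c)
  from assms(2) show ?case
  proof (induction rule: trig.induct)
    case (wave h d)
    then show ?case using trig.wave[of "g + h" R "c * d"] assms(3) \<open>g \<in> P\<close>
      by (simp add: wave_add mult_ac)
  qed (auto simp: distrib_left intro: trig.intros)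
qed (auto simp: distrib_right intro: trig.intros)

lemma trig_continuous: "trig P f \<Longrightarrow> continuous_on S f"
  by (induction rule: trig.induct) (auto intro!: continuous_intros)

text \<open>For real coefficients and finite \<open>B\<close> this adds up the coefficients of
  \<open>f\<close> at the frequencies in \<open>B\<close>.\<close>

definition pairing :: "int set \<Rightarrow> (real \<Rightarrow> complex) \<Rightarrow> real"
  where "pairing B f = Re (LINT x:{0..1}|lborel. f x * cnj (exp_sum B x))"

lemma pairing_integrable:
  "trig P f \<Longrightarrow> set_integrable lborel {0..1} (\<lambda>x. f x * cnj (exp_sum B x))"
  by (intro borel_integrable_atLeastAtMost' continuous_intros trig_continuous)

lemma pairing_add:
  assumes "trig P f" "trig Q f'"
  shows "pairing B (\<lambda>x. f x + f' x) = pairing B f + pairing B f'"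
  using pairing_integrable[OF assms(1), of B] pairing_integrable[OF assms(2), of B]
  by (simp add: pairing_def distrib_right set_integral_add)

lemma pairing_scale: "pairing B (\<lambda>x. of_real c * f x) = c * pairing B f"
  by (simp add: pairing_def mult.assoc)

lemma pairing_sum:
  assumes "finite I" "\<And>i. i \<in> I \<Longrightarrow> trig P (f i)"
  shows "pairing B (\<lambda>x. \<Sum>i\<in>I. f i x) = (\<Sum>i\<in>I. pairing B (f i))"
  using assms
proof (induction I rule: finite_induct)
  case empty
  then show ?case by (simp add: pairing_def)
next
  case (insert i I)
  then show ?case
    by (simp add: pairing_add[of P "f i" P] trig_sum)
qed

lemma pairing_wave:
  assumes "finite B"
  shows "pairing B (wave n) = (if n \<in> B then 1 else 0)"
proof -
  have "wave n x * cnj (exp_sum B x) = (\<Sum>b\<in>B. wave (n - b) x)" for x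
    by (simp add: exp_sum_wave sum_distrib_left cnj_wave flip: wave_add)
  moreover have "set_integrable lborel {0..1} (wave a)" for a
    by (intro borel_integrable_atLeastAtMost' continuous_intros)
  ultimately have "pairing B (wave n) = Re (\<Sum>b\<in>B. LINT x:{0..1}|lborel. wave (n - b) x)"
    unfolding pairing_def set_lebesgue_integral_def set_integrable_def
    by (simp add: scaleR_sum_right integral_sum)
  also have "\<dots> = (\<Sum>b\<in>B. if b = n then 1 else 0)"
    unfolding integral_wave Re_sum by (intro sum.cong) auto
  finally show ?thesis using assms by simp
qed

lemma pairing_eq_0:
  assumes "finite B" "trig P f" "\<And>g. g \<in> P \<Longrightarrow> snd g \<notin> B"
  shows "pairing B f = 0"
  using assms(2)
proof (induction rule: trig.induct)
  case zero
  then show ?case by (simp add: pairing_def)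
next
  case (wave g c)
  then show ?case using assms by (simp add: pairing_scale pairing_wave)
next
  case (add f f')
  then show ?case by (simp add: pairing_add[of P f P])
qed

text \<open>Duality: a test function bounded by 1 certifies a lower bound for the norm. All that
  follows builds one with a large pairing.\<close>

lemma pairing_le_L1:
  assumes "trig P f" "\<And>x. cmod (f x) \<le> 1"
  shows "pairing B f \<le> L1_norm_exp_sum B"
proof -
  have "pairing B f \<le> cmod (LINT x:{0..1}|lborel. f x * cnj (exp_sum B x))"
    unfolding pairing_def by (rule complex_Re_le_cmod)
  also have "\<dots> \<le> (LINT x:{0..1}|lborel. cmod (f x * cnj (exp_sum B x)))"
    using set_integral_norm_bound[OF pairing_integrable[OF assms(1)]] .
  also have "\<dots> \<le> (LINT x:{0..1}|lborel. cmod (exp_sum B x))"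
  proof (rule set_integral_mono)
    show "set_integrable lborel {0..1} (\<lambda>x. cmod (f x * cnj (exp_sum B x)))"
      using set_integrable_norm[OF pairing_integrable[OF assms(1)]] .
    show "set_integrable lborel {0..1} (\<lambda>x. cmod (exp_sum B x))"
      by (intro borel_integrable_atLeastAtMost' continuous_intros)
    show "cmod (f x * cnj (exp_sum B x)) \<le> cmod (exp_sum B x)" for x
      using assms(2)[of x] by (simp add: norm_mult mult_left_le_one_le)
  qed
  finally show ?thesis by (simp add: L1_norm_exp_sum_def)
qed

subsection \<open>The pointwise inequality\<close>

text \<open>Half of the off-diagonal part of \<open>|Z|^2\<close>, the other half being its
  conjugate. With \<open>i < j\<close> only, all frequency differences point the same way once the
  positions decrease.\<close>

definition pair_sum :: "(nat \<Rightarrow> complex) \<Rightarrow> nat \<Rightarrow> complex"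
  where "pair_sum z m = (\<Sum>j<m. \<Sum>i<j. z i * cnj (z j))"

lemma norm_sum_squared:
  "(cmod (\<Sum>i<m. z i))\<^sup>2 = (\<Sum>i<m. (cmod (z i))\<^sup>2) + 2 * Re (pair_sum z m)"
proof (induction m)
  case (Suc m)
  have *: "(cmod (a + b))\<^sup>2 = (cmod a)\<^sup>2 + (cmod b)\<^sup>2 + 2 * Re (a * cnj b)" for a b
    unfolding cmod_power2 by (simp add: power2_eq_square algebra_simps)
  have "pair_sum z (Suc m) = pair_sum z m + (\<Sum>i<m. z i) * cnj (z m)"
    by (simp add: pair_sum_def sum_distrib_right)
  then show ?case
    by (simp add: * Suc.IH)
qed (simp add: pair_sum_def)

text \<open>There are \<open>m * (m - 1) / 2\<close> pairs, each contributing at most 1. This gives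
  \<open>|V| \<le> 1\<close> for the \<open>V\<close> in \<open>damping\<close>.\<close>

lemma norm_pair_sum_le:
  assumes "\<And>i. i < m \<Longrightarrow> cmod (z i) \<le> 1"
  shows "2 * cmod (pair_sum z m) \<le> real m * (real m - 1)"
  using assms
proof (induction m)
  case (Suc m)
  have "cmod (\<Sum>i<m. z i * cnj (z m)) \<le> (\<Sum>i<m. 1)"
    using Suc.prems by (intro sum_norm_le) (simp add: norm_mult mult_le_one)
  then have "cmod (pair_sum z (Suc m)) \<le> cmod (pair_sum z m) + real m"
    unfolding pair_sum_def sum.lessThan_Suc
    by (intro norm_triangle_le) simp
  moreover have "2 * cmod (pair_sum z m) \<le> real m * (real m - 1)"
    using Suc by simp
  ultimately show ?case by (simp add: algebra_simps)
qed (simp add: pair_sum_def)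

text \<open>The constant \<open>1 / m\<close> in \<open>V\<close> bounds the diagonal part of
  \<open>|Z / m|^2\<close>, so \<open>Re V\<close> dominates \<open>|Z / m|^2\<close> while only the
  frequencies of \<open>pair_sum\<close> and its square enter.\<close>

definition damping :: "(nat \<Rightarrow> complex) \<Rightarrow> nat \<Rightarrow> complex"
  where "damping z m =
    (let V = 1 / of_nat m + 2 * pair_sum z m / (of_nat m)\<^sup>2 in 1 - V / 4 + V\<^sup>2 / 16)"

text \<open>A linear factor \<open>1 - V / 4\<close> would exceed 1 in modulus when \<open>V\<close> is
  nearly imaginary; the quadratic term compensates the imaginary part.\<close>

lemma norm_quadratic_le:
  assumes "cmod V \<le> 1" "Re V \<ge> 0"
  shows "cmod (1 - V / 4 + V\<^sup>2 / 16) \<le> 1 - Re V / 8"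
proof (rule power2_le_imp_le)
  define u v where "u = Re V" and "v = Im V"
  have uv: "u\<^sup>2 + v\<^sup>2 \<le> 1"
    using power_mono[OF assms(1), of 2] by (simp add: u_def v_def cmod_power2)
  have u: "0 \<le> u" "u \<le> 1"
    using assms complex_Re_le_cmod[of V] by (auto simp: u_def)
  have "(cmod (1 - V / 4 + V\<^sup>2 / 16))\<^sup>2 =
      (1 - u / 4 + (u\<^sup>2 - v\<^sup>2) / 16)\<^sup>2 + (- v / 4 + u * v / 8)\<^sup>2"
    by (simp add: cmod_power2 u_def v_def Re_power2 Im_power2 mult.commute)
  also have "\<dots> = 1 - u / 2 + 3 * u\<^sup>2 / 16 - v\<^sup>2 / 16 - u * (u\<^sup>2 + v\<^sup>2) / 32 + (u\<^sup>2 + v\<^sup>2)\<^sup>2 / 256"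
    by (simp add: power2_eq_square field_simps)
  \<comment> \<open>Without the quadratic term, \<open>v^2 / 16\<close> would enter with a plus
    sign. With the minus sign it absorbs the \<open>v^2\<close> from the last summand, and
    \<open>u^2 \<le> u\<close> leaves at most \<open>- u / 2 + 3 * u / 16 + u / 256\<close>.\<close>
  also have "\<dots> \<le> 1 - u / 4"
  proof -
    have "(u\<^sup>2 + v\<^sup>2)\<^sup>2 \<le> u\<^sup>2 + v\<^sup>2"
      using uv by (simp add: power2_eq_square mult_left_le)
    moreover have "u\<^sup>2 \<le> u" using u by (simp add: power2_eq_square mult_left_le)
    moreover have "u * (u\<^sup>2 + v\<^sup>2) \<ge> 0" using u by simp
    moreover have "v\<^sup>2 \<ge> 0" by simp
    ultimately show ?thesis using u(1) by linarith
  qed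
  also have "\<dots> \<le> (1 - Re V / 8)\<^sup>2"
    by (simp add: u_def power2_eq_square algebra_simps)
  finally show "(cmod (1 - V / 4 + V\<^sup>2 / 16))\<^sup>2 \<le> (1 - Re V / 8)\<^sup>2" .
  show "0 \<le> 1 - Re V / 8" using u by (simp add: u_def)
qed

text \<open>With \<open>t = |Z| / m\<close>, damping frees \<open>t^2 / 8\<close> and the factor
  \<open>1 - \<eta>\<close> frees about \<open>\<eta>\<close>; the added term costs only
  \<open>sqrt \<eta> * t / 2\<close>.\<close>

lemma norm_step_le:
  assumes "\<And>i. i < m \<Longrightarrow> cmod (z i) \<le> 1" "m > 0" "cmod w \<le> 1" "0 \<le> \<eta>" "\<eta> \<le> 1 / 2"
  shows "cmod (of_real (1 - \<eta>) * (w * damping z m) +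
    of_real (sqrt \<eta> / (2 * real m)) * (\<Sum>i<m. z i)) \<le> 1"
proof -
  define V where "V = 1 / of_nat m + 2 * pair_sum z m / (of_nat m)\<^sup>2"
  define t where "t = cmod (\<Sum>i<m. z i) / real m"
  have "(cmod (\<Sum>i<m. z i))\<^sup>2 \<le> real m + 2 * Re (pair_sum z m)"
  proof -
    have "(\<Sum>i<m. (cmod (z i))\<^sup>2) \<le> (\<Sum>i<m. 1)"
      using assms(1) by (intro sum_mono) (simp add: power_le_one)
    then show ?thesis by (simp add: norm_sum_squared)
  qed
  moreover have "Re V = (real m + 2 * Re (pair_sum z m)) / (real m)\<^sup>2"
  proof -
    have "V = of_real (1 / real m) + of_real (2 / (real m)\<^sup>2) * pair_sum z m"
      by (simp add: V_def)
    then have "Re V = 1 / real m + 2 / (real m)\<^sup>2 * Re (pair_sum z m)"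
      by simp
    then show ?thesis using assms(2) by (simp add: field_simps power2_eq_square)
  qed
  ultimately have tV: "t\<^sup>2 \<le> Re V"
    by (simp add: t_def power_divide divide_right_mono)
  have "cmod V \<le> 1 / real m + 2 * cmod (pair_sum z m) / (real m)\<^sup>2"
    unfolding V_def by (rule norm_triangle_le) (simp add: norm_divide norm_mult norm_power)
  also have "\<dots> \<le> 1 / real m + real m * (real m - 1) / (real m)\<^sup>2"
    using norm_pair_sum_le[OF assms(1)] by (intro add_left_mono divide_right_mono) auto
  also have "\<dots> = 1" using assms(2) by (simp add: field_simps power2_eq_square)
  finally have V1: "cmod V \<le> 1" .
  have V0: "Re V \<ge> 0" using tV zero_le_power2[of t] by linarith
  have "damping z m = 1 - V / 4 + V\<^sup>2 / 16"
    by (simp add: damping_def V_def Let_def)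
  then have D: "cmod (damping z m) \<le> 1 - t\<^sup>2 / 8"
    using norm_quadratic_le[OF V1 V0] tV by simp
  have "cmod (of_real (1 - \<eta>) * (w * damping z m)) \<le> (1 - \<eta>) * (1 * (1 - t\<^sup>2 / 8))"
    unfolding norm_mult norm_of_real using assms D by (intro mult_mono) auto
  moreover have "cmod (of_real (sqrt \<eta> / (2 * real m)) * (\<Sum>i<m. z i)) = sqrt \<eta> * t / 2"
    using assms by (simp add: norm_mult norm_divide t_def)
  moreover have "(1 - \<eta>) * (1 * (1 - t\<^sup>2 / 8)) + sqrt \<eta> * t / 2 \<le> 1"
  proof -
    \<comment> \<open>The square is balanced so that the cost is at most
      \<open>\<eta> + t^2 / 16\<close>; the cross term \<open>\<eta> * t^2 / 8\<close> uses at most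
      the other half of the room \<open>t^2 / 8\<close>.\<close>
    have "(sqrt \<eta> - t / 4)\<^sup>2 \<ge> 0" by simp
    then have "sqrt \<eta> * t / 2 \<le> \<eta> + t\<^sup>2 / 16"
      using assms by (simp add: power2_diff power_divide mult.commute)
    moreover have "\<eta> * t\<^sup>2 \<le> 1 / 2 * t\<^sup>2"
      using assms by (intro mult_right_mono) auto
    moreover have "(1 - \<eta>) * (1 * (1 - t\<^sup>2 / 8)) = 1 - \<eta> - t\<^sup>2 / 8 + \<eta> * t\<^sup>2 / 8"
      by (simp add: field_simps)
    ultimately show ?thesis by linarith
  qed
  ultimately show ?thesis by (intro norm_triangle_le) linarith
qed

text \<open>Separates the constant term, which multiplies the old pairing, from the terms in
  \<open>W\<close> and \<open>W^2\<close>, whose frequencies will be steered away from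
  \<open>B\<close>.\<close>

lemma damping_expand:
  assumes "m > 0"
  defines "M \<equiv> real m"
  shows "damping z m = of_real (1 - 1 / (4 * M) + 1 / (16 * M\<^sup>2)) +
    of_real (1 / (4 * M ^ 3) - 1 / (2 * M\<^sup>2)) * pair_sum z m +
    of_real (1 / (4 * M ^ 4)) * (pair_sum z m * pair_sum z m)"
  using assms(1) unfolding damping_def M_def Let_def
  by (simp add: field_simps power2_eq_square power3_eq_cube power4_eq_xxxx)

subsection \<open>Selecting positions\<close>

text \<open>Shifts caused by a factor \<open>W\<close>; \<open>gaps2\<close> collects those of
  \<open>W\<close> and \<open>W^2\<close>.\<close>

definition gaps :: "(nat \<Rightarrow> int) \<Rightarrow> nat \<Rightarrow> int set"
  where "gaps n m = {n i - n j |i j. i < j \<and> j < m}"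

definition gaps2 :: "(nat \<Rightarrow> int) \<Rightarrow> nat \<Rightarrow> int set"
  where "gaps2 n m = gaps n m \<union> {p + q |p q. p \<in> gaps n m \<and> q \<in> gaps n m}"

lemma gaps_image: "gaps n m \<subseteq> (\<lambda>(i, j). n i - n j) ` ({..<m} \<times> {..<m})"
  unfolding gaps_def by fastforce

lemma gaps2_image: "gaps2 n m \<subseteq> gaps n m \<union> (\<lambda>(p, q). p + q) ` (gaps n m \<times> gaps n m)"
  unfolding gaps2_def by auto

lemma finite_gaps: "finite (gaps n m)"
  by (rule finite_subset[OF gaps_image]) simp

lemma finite_gaps2: "finite (gaps2 n m)"
  by (rule finite_subset[OF gaps2_image]) (simp add: finite_gaps)

lemma card_gaps_le: "card (gaps n m) \<le> m\<^sup>2"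
  using surj_card_le[OF _ gaps_image, of m n] by (simp add: power2_eq_square)

lemma card_gaps2_le: "card (gaps2 n m) \<le> m\<^sup>2 + m ^ 4"
proof -
  have "card (gaps2 n m) \<le> card (gaps n m \<union> (\<lambda>(p, q). p + q) ` (gaps n m \<times> gaps n m))"
    by (rule card_mono[OF _ gaps2_image]) (simp add: finite_gaps)
  also have "\<dots> \<le> card (gaps n m) + card (gaps n m \<times> gaps n m)"
    by (intro card_Un_le[THEN order_trans] add_left_mono card_image_le) (simp add: finite_gaps)
  also have "\<dots> \<le> m\<^sup>2 + m\<^sup>2 * m\<^sup>2"
    unfolding card_cartesian_product by (intro add_mono mult_mono card_gaps_le) auto
  finally show ?thesis by (simp add: power2_eq_square power4_eq_xxxx)
qed

lemma gaps2_pos: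
  assumes "\<And>i j. i < j \<Longrightarrow> j < m \<Longrightarrow> n j < n i" "d \<in> gaps2 n m"
  shows "d > 0"
proof -
  have "p > 0" if "p \<in> gaps n m" for p
    using that assms(1) by (auto simp: gaps_def)
  then show ?thesis using assms(2) by (auto simp: gaps2_def intro: add_pos_pos)
qed

text \<open>The coefficient of \<open>n j\<close> in a new element is \<open>-1\<close> or \<open>-2\<close>, never \<open>0\<close>, so forbidding
  a given value excludes only boundedly many choices of \<open>n j\<close>.\<close>

lemma gaps2_Suc:
  "gaps2 n (Suc j) \<subseteq> gaps2 n j \<union> {n i + p - n j |i p. i < j \<and> p \<in> insert 0 (gaps n j)}
     \<union> {n i + n i' - 2 * n j |i i'. i < j \<and> i' < j}"
proof -
  have g: "gaps n (Suc j) = gaps n j \<union> {n i - n j |i. i < j}"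
    unfolding gaps_def by (auto simp: less_Suc_eq)
  have "p + q \<in> gaps2 n j \<union> {n i + p - n j |i p. i < j \<and> p \<in> insert 0 (gaps n j)}
     \<union> {n i + n i' - 2 * n j |i i'. i < j \<and> i' < j}"
    if "p \<in> gaps n (Suc j)" "q \<in> gaps n (Suc j)" for p q
  proof -
    consider "p \<in> gaps n j" "q \<in> gaps n j"
      | i where "p \<in> gaps n j" "q = n i - n j" "i < j"
      | i where "q \<in> gaps n j" "p = n i - n j" "i < j"
      | i i' where "p = n i - n j" "i < j" "q = n i' - n j" "i' < j"
      using \<open>p \<in> gaps n (Suc j)\<close> \<open>q \<in> gaps n (Suc j)\<close> unfolding g by blast
    then show ?thesis
    proof cases
      case 1
      then show ?thesis by (auto simp: gaps2_def)
    next
      case 2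
      then have "p + q = n i + p - n j" by simp
      then show ?thesis using 2 by blast
    next
      case 3
      then have "p + q = n i + q - n j" by simp
      then show ?thesis using 3 by blast
    next
      case 4
      then have "p + q = n i + n i' - 2 * n j" by simp
      then show ?thesis using 4 by blast
    qed
  qed
  moreover have "gaps n (Suc j) \<subseteq> gaps2 n j \<union> {n i + p - n j |i p. i < j \<and> p \<in> insert 0 (gaps n j)}"
  proof
    fix p assume "p \<in> gaps n (Suc j)"
    then consider "p \<in> gaps n j" | i where "i < j" "p = n i + 0 - n j"
      unfolding g by auto
    then show "p \<in> gaps2 n j \<union> {n i + p - n j |i p. i < j \<and> p \<in> insert 0 (gaps n j)}"
      by cases (simp add: gaps2_def, blast)
  qed
  ultimately show ?thesis unfolding gaps2_def[of n "Suc j"] by blast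
qed

text \<open>Positions are taken from the top of \<open>Y\<close>, always the largest admissible one.
  The last conclusion says that few elements of \<open>Y\<close> lie at or above a chosen position;
  it drives the induction and later bounds the growth of \<open>excess\<close>.\<close>

lemma greedy_selection:
  fixes Y D :: "int set"
  assumes "finite Y" "finite D" and E: "3 * m ^ 3 * card D \<le> E" and "j \<le> m" "j * (1 + E) \<le> card Y"
  shows "\<exists>n. (\<forall>i<j. n i \<in> Y) \<and> (\<forall>i i'. i < i' \<longrightarrow> i' < j \<longrightarrow> n i' < n i) \<and>
    D \<inter> gaps2 n j = {} \<and> card {a \<in> Y. \<exists>i<j. n i \<le> a} \<le> j * (1 + E)"
  using assms(4,5)
proof (induction j)
  case 0
  then show ?case by (auto simp: gaps2_def gaps_def)
next
  case (Suc j)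
  then obtain n where n: "\<And>i. i < j \<Longrightarrow> n i \<in> Y" "\<And>i i'. i < i' \<Longrightarrow> i' < j \<Longrightarrow> n i' < n i"
      "D \<inter> gaps2 n j = {}" "card {a \<in> Y. \<exists>i<j. n i \<le> a} \<le> j * (1 + E)"
    by auto
  define T where "T = {a \<in> Y. \<exists>i<j. n i \<le> a}"
  \<comment> \<open>Values of \<open>n j\<close> that would put an element of \<open>D\<close> into
    the new gaps, in the two shapes of \<open>gaps2_Suc\<close>. The division in \<open>X2\<close>
    is exact whenever the equation for \<open>n j\<close> is solvable.\<close>
  define X1 where "X1 = (\<lambda>(i, p, d). n i + p - d) ` ({..<j} \<times> insert 0 (gaps n j) \<times> D)"
  define X2 where "X2 = (\<lambda>(i, i', d). (n i + n i' - d) div 2) ` ({..<j} \<times> {..<j} \<times> D)"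
  have fin: "finite T" "finite X1" "finite X2"
    using assms by (auto simp: T_def X1_def X2_def finite_gaps)
  have "card X1 \<le> j * (card (insert 0 (gaps n j)) * card D)"
    unfolding X1_def using assms
    by (intro card_image_le[THEN order_trans]) (auto simp: finite_gaps card_cartesian_product)
  also have "\<dots> \<le> m * ((1 + m\<^sup>2) * card D)"
  proof -
    have "card (insert 0 (gaps n j)) \<le> 1 + m\<^sup>2"
      using card_gaps_le[of n j] power_mono[of j m 2] Suc.prems
      by (intro card_insert_le_m1) linarith+
    then show ?thesis using Suc.prems by (intro mult_mono) auto
  qed
  finally have c1: "card X1 \<le> m * ((1 + m\<^sup>2) * card D)" .
  have "card X2 \<le> j * (j * card D)"
    unfolding X2_def using assms
    by (intro card_image_le[THEN order_trans]) (auto simp: card_cartesian_product)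
  also have "\<dots> \<le> m * (m * card D)" using Suc.prems by (intro mult_mono) auto
  finally have c2: "card X2 \<le> m * (m * card D)" .
  have cE: "card (X1 \<union> X2) \<le> E"
  proof -
    have "m * (1 + m\<^sup>2) + m * m \<le> 3 * m ^ 3"
    proof -
      have "m * m \<le> m ^ 3" "m \<le> m * m"
        by (auto simp: power3_eq_cube)
      moreover have "m * (1 + m\<^sup>2) + m * m = m + m ^ 3 + m * m"
        by (simp add: power2_eq_square power3_eq_cube algebra_simps)
      ultimately show ?thesis by linarith
    qed
    then have "(m * (1 + m\<^sup>2) + m * m) * card D \<le> 3 * m ^ 3 * card D"
      by (rule mult_right_mono) simp
    then show ?thesis using c1 c2 E card_Un_le[of X1 X2] by (simp add: algebra_simps)
  qed
  define R where "R = Y - T - (X1 \<union> X2)"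
  \<comment> \<open>At most \<open>j * (1 + E) + E\<close> elements are excluded, one fewer than
    \<open>Suc j * (1 + E)\<close>.\<close>
  have "R \<noteq> {}"
  proof
    assume "R = {}"
    then have "Y \<subseteq> T \<union> (X1 \<union> X2)" by (auto simp: R_def)
    then have "card Y \<le> card (T \<union> (X1 \<union> X2))" using fin by (intro card_mono) auto
    then show False
      using card_Un_le[of T "X1 \<union> X2"] cE n(4) Suc.prems unfolding T_def by simp
  qed
  \<comment> \<open>By maximality, an element of \<open>Y\<close> at or above \<open>v\<close> is
    \<open>v\<close> itself, excluded, or already in \<open>T\<close>; so \<open>T\<close> grows by
    at most \<open>1 + E\<close>.\<close>
  define v where "v = Max R"
  have finR: "finite R" using assms by (simp add: R_def)
  have v: "v \<in> R" "\<And>a. a \<in> R \<Longrightarrow> a \<le> v"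
    using \<open>R \<noteq> {}\<close> finR by (auto simp: v_def)
  define n' where "n' = n(j := v)"
  have n'_simps: "n' j = v" "\<And>i. i < j \<Longrightarrow> n' i = n i" by (auto simp: n'_def)
  have gj: "gaps n' j = gaps n j" "gaps2 n' j = gaps2 n j"
  proof -
    show "gaps n' j = gaps n j"
      unfolding gaps_def by (intro Collect_cong iff_exI) (auto simp: n'_def)
    then show "gaps2 n' j = gaps2 n j" unfolding gaps2_def by simp
  qed
  have "\<forall>i<Suc j. n' i \<in> Y"
    using n(1) v(1) by (auto simp: n'_def R_def)
  moreover have "\<forall>i i'. i < i' \<longrightarrow> i' < Suc j \<longrightarrow> n' i' < n' i"
  proof (intro allI impI)
    fix i i' assume "i < i'" "i' < Suc j"
    then show "n' i' < n' i"
      using n(2)[of i i'] v(1) by (cases "i' = j") (auto simp: n'_def R_def T_def not_le)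
  qed
  moreover have "D \<inter> gaps2 n' (Suc j) = {}"
  proof -
    have False if d: "d \<in> D" "d \<in> gaps2 n' (Suc j)" for d
    proof -
      consider "d \<in> gaps2 n' j"
        | i p where "i < j" "p \<in> insert 0 (gaps n' j)" "d = n' i + p - n' j"
        | i i' where "i < j" "i' < j" "d = n' i + n' i' - 2 * n' j"
        using gaps2_Suc[of n' j] d(2) by blast
      then show False
      proof cases
        case 1
        then show ?thesis using n(3) d(1) gj by auto
      next
        case 2
        then have "v = n i + p - d" by (simp add: n'_simps)
        moreover have "(i, p, d) \<in> {..<j} \<times> insert 0 (gaps n j) \<times> D" using 2 d(1) gj by simp
        ultimately have "v \<in> X1"
          unfolding X1_def by (intro image_eqI[where x = "(i, p, d)"]) simp
        then show ?thesis using v(1) by (simp add: R_def)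
      next
        case 3
        then have "v = (n i + n i' - d) div 2" by (simp add: n'_simps)
        moreover have "(i, i', d) \<in> {..<j} \<times> {..<j} \<times> D" using 3 d(1) by simp
        ultimately have "v \<in> X2"
          unfolding X2_def by (intro image_eqI[where x = "(i, i', d)"]) simp
        then show ?thesis using v(1) by (simp add: R_def)
      qed
    qed
    then show ?thesis by auto
  qed
  moreover have "card {a \<in> Y. \<exists>i<Suc j. n' i \<le> a} \<le> Suc j * (1 + E)"
  proof -
    have "{a \<in> Y. \<exists>i<Suc j. n' i \<le> a} \<subseteq> T \<union> insert v (X1 \<union> X2)"
      using v(2) by (fastforce simp: T_def R_def n'_def less_Suc_eq)
    then have "card {a \<in> Y. \<exists>i<Suc j. n' i \<le> a} \<le> card (T \<union> insert v (X1 \<union> X2))"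
      using fin by (intro card_mono) auto
    also have "\<dots> \<le> card T + card (insert v (X1 \<union> X2))" by (rule card_Un_le)
    also have "\<dots> \<le> j * (1 + E) + (1 + E)"
      using n(4) cE card_insert_le_m1[of "1 + E" "X1 \<union> X2" v] unfolding T_def
      by (intro add_mono) auto
    finally show ?thesis by simp
  qed
  ultimately show ?case by blast
qed

text \<open>Frequencies only move upwards, so this set measures how many shifts can still hit \<open>Y\<close>. Its
  cardinality grows by a bounded factor in each step, whereas a bound through
  \<open>card U * card Y\<close> would be quadratic in the exponent.\<close>

definition excess :: "int set \<Rightarrow> int set \<Rightarrow> int set"
  where "excess Y U = {a - u |a u. a \<in> Y \<and> u \<in> U \<and> u < a}"

lemma finite_excess: "finite Y \<Longrightarrow> finite U \<Longrightarrow> finite (excess Y U)"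
  by (rule finite_subset[of _ "(\<lambda>(a, u). a - u) ` (Y \<times> U)"]) (auto simp: excess_def)

text \<open>Coordinates after one step: the old ones, unshifted or moved by \<open>W\<close> or
  \<open>W^2\<close>, and the new positions contributed by \<open>Z\<close>.\<close>

definition shifted :: "int set \<Rightarrow> (nat \<Rightarrow> int) \<Rightarrow> nat \<Rightarrow> int set"
  where "shifted U n m = {u + d |u d. u \<in> U \<and> d \<in> insert 0 (gaps2 n m)} \<union> n ` {..<m}"

text \<open>A shift \<open>d > 0\<close> taking some \<open>u\<close> into \<open>Y\<close> would
  itself belong to \<open>excess Y U\<close>, so this set is the one to be avoided by
  \<open>greedy_selection\<close>.\<close>

lemma selection_step:
  fixes Y U :: "int set"
  assumes "finite Y" "finite U" "m > 0" and large: "3 * m ^ 4 * (card (excess Y U) + 1) \<le> card Y"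
  obtains n where "\<And>i. i < m \<Longrightarrow> n i \<in> Y" "\<And>u d. u \<in> U \<Longrightarrow> d \<in> gaps2 n m \<Longrightarrow> u + d \<notin> Y"
    "finite (shifted U n m)"
    "card (excess Y (shifted U n m)) + 1 \<le> 8 * m ^ 5 * (card (excess Y U) + 1)"
proof -
  define D where "D = excess Y U"
  define E where "E = 3 * m ^ 3 * card D"
  have finD: "finite D" using assms by (simp add: D_def finite_excess)
  have mE: "m * (1 + E) \<le> 3 * m ^ 4 * (card D + 1)"
  proof -
    have "m \<le> m ^ 4" using assms(3) by (simp add: self_le_power)
    moreover have "m * E = 3 * m ^ 4 * card D"
      by (simp add: E_def power3_eq_cube power4_eq_xxxx)
    ultimately show ?thesis by (simp add: algebra_simps)
  qed
  have "m * (1 + E) \<le> card Y" using mE large by (simp add: D_def)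
  from greedy_selection[OF assms(1) finD eq_imp_le[OF E_def[symmetric]] order_refl this]
  obtain n where n': "(\<forall>i<m. n i \<in> Y) \<and> (\<forall>i i'. i < i' \<longrightarrow> i' < m \<longrightarrow> n i' < n i) \<and>
      D \<inter> gaps2 n m = {} \<and> card {a \<in> Y. \<exists>i<m. n i \<le> a} \<le> m * (1 + E)"
    by (rule exE)
  note n = n'[THEN conjunct1, rule_format] n'[THEN conjunct2, THEN conjunct1, rule_format]
    n'[THEN conjunct2, THEN conjunct2, THEN conjunct1]
    n'[THEN conjunct2, THEN conjunct2, THEN conjunct2]
  have pos: "d > 0" if "d \<in> gaps2 n m" for d
    using that by (rule gaps2_pos[of m n, rotated]) (rule n(2))
  have avoid: "u + d \<notin> Y" if "u \<in> U" "d \<in> gaps2 n m" for u d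
  proof
    assume "u + d \<in> Y"
    moreover have "u < u + d" using pos that by simp
    ultimately have "(u + d) - u \<in> D" unfolding D_def excess_def using that(1) by blast
    then show False using n(3) that by auto
  qed
  have fin: "finite (shifted U n m)"
    by (rule finite_subset[of _ "(\<lambda>(u, d). u + d) ` (U \<times> insert 0 (gaps2 n m)) \<union> n ` {..<m}"])
      (auto simp: shifted_def assms finite_gaps2)
  define T where "T = {a \<in> Y. \<exists>i<m. n i \<le> a}"
  have finT: "finite T" using assms by (simp add: T_def)
  \<comment> \<open>A new excess is an old one lowered by a shift, or the height of an element of
    \<open>T\<close> above a new position.\<close>
  have "excess Y (shifted U n m) \<subseteq>
      (\<lambda>(\<delta>, d). \<delta> - d) ` (D \<times> insert 0 (gaps2 n m)) \<union> (\<lambda>(a, i). a - n i) ` (T \<times> {..<m})"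
  proof
    fix x assume "x \<in> excess Y (shifted U n m)"
    then obtain a w where aw: "x = a - w" "a \<in> Y" "w \<in> shifted U n m" "w < a"
      by (auto simp: excess_def)
    then consider u d where "u \<in> U" "d \<in> insert 0 (gaps2 n m)" "w = u + d" | i where "i < m" "w = n i"
      by (auto simp: shifted_def)
    then show "x \<in> (\<lambda>(\<delta>, d). \<delta> - d) ` (D \<times> insert 0 (gaps2 n m)) \<union> (\<lambda>(a, i). a - n i) ` (T \<times> {..<m})"
    proof cases
      case 1
      then have "u < a" using aw(4) pos[of d] by auto
      then have "a - u \<in> D" unfolding D_def excess_def using 1 aw by blast
      moreover have "x = (a - u) - d" using aw 1 by simp
      ultimately show ?thesis using 1 by force
    next
      case 2
      then have "a \<in> T" using aw by (auto simp: T_def)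
      then show ?thesis using 2 aw by force
    qed
  qed
  then have "card (excess Y (shifted U n m)) \<le>
      card ((\<lambda>(\<delta>, d). \<delta> - d) ` (D \<times> insert 0 (gaps2 n m)) \<union> (\<lambda>(a, i). a - n i) ` (T \<times> {..<m}))"
    by (rule card_mono[rotated]) (simp add: finD finT finite_gaps2)
  also have "\<dots> \<le> card (D \<times> insert 0 (gaps2 n m)) + card (T \<times> {..<m})"
    by (intro card_Un_le[THEN order_trans] add_mono card_image_le) (auto simp: finD finT finite_gaps2)
  also have "\<dots> \<le> card D * (1 + (m\<^sup>2 + m ^ 4)) + m * (1 + E) * m"
    unfolding card_cartesian_product
    using n(4) card_insert_le_m1[of "1 + (m\<^sup>2 + m ^ 4)" "gaps2 n m" 0] card_gaps2_le[of n m]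
    by (intro add_mono mult_mono) (auto simp: T_def)
  also have "\<dots> + 1 \<le> 8 * m ^ 5 * (card D + 1)"
  proof -
    have m5: "1 \<le> m ^ 5" "m\<^sup>2 \<le> m ^ 5" "m ^ 4 \<le> m ^ 5"
      using assms(3) by (auto intro!: power_increasing)
    have "card D * (1 + (m\<^sup>2 + m ^ 4)) \<le> card D * (3 * m ^ 5)"
      using m5 by (intro mult_left_mono) auto
    moreover have "m * (1 + E) * m = m\<^sup>2 + 3 * m ^ 5 * card D"
      by (simp add: E_def power2_eq_square power3_eq_cube numeral_eq_Suc algebra_simps)
    ultimately show ?thesis using m5(1,2) by (simp add: algebra_simps)
  qed
  finally have "card (excess Y (shifted U n m)) + 1 \<le> 8 * m ^ 5 * (card (excess Y U) + 1)"
    by (simp add: D_def)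
  then show thesis using that n(1) avoid fin by blast
qed

subsection \<open>Iteration along one coordinate\<close>

text \<open>One level of the construction. \<open>X n\<close> stands for frequencies of degree
  \<open>n\<close>, that is \<open>n + 1\<close> points minus \<open>n\<close> points;
  \<open>h\<close> is the coordinate in play and \<open>Y\<close> its set of values. The blocks
  \<open>\<Phi> y\<close> have degree \<open>e\<close>, sit at coordinate \<open>y\<close> and serve
  as the \<open>z_i\<close>. The Freiman isomorphism enters through \<open>in_Y\<close>.\<close>

locale test_family =
  fixes X :: "nat \<Rightarrow> ('g::ab_group_add \<times> int) set" and h :: "'g \<times> int \<Rightarrow> int"
    and B Y :: "int set" and k e :: nat and \<mu> :: real and \<Phi> :: "int \<Rightarrow> real \<Rightarrow> complex"
  assumes finite_B: "finite B" and finite_Y: "finite Y"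
    and h_add: "h (g + g') = h g + h g'" and h_uminus: "h (- g) = - h g"
    and X_mono: "n \<le> n' \<Longrightarrow> X n \<subseteq> X n'"
    and X_diff: "g \<in> X n \<Longrightarrow> x \<in> X e \<Longrightarrow> x' \<in> X e \<Longrightarrow> g + (x - x') \<in> X (n + (2 * e + 1))"
    and in_Y: "g \<in> X n \<Longrightarrow> n < k \<Longrightarrow> snd g \<in> B \<Longrightarrow> h g \<in> Y"
    and \<Phi>_trig: "y \<in> Y \<Longrightarrow> trig {g \<in> X e. h g = y} (\<Phi> y)"
    and \<Phi>_le: "y \<in> Y \<Longrightarrow> cmod (\<Phi> y s) \<le> 1"
    and \<Phi>_pairing: "y \<in> Y \<Longrightarrow> \<mu> \<le> pairing B (\<Phi> y)"
    and \<mu>_nonneg: "0 \<le> \<mu>"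
begin

text \<open>Terms containing \<open>W\<close> are invisible to \<open>B\<close>, so the pairing is
  only multiplied by the constant part and gains from \<open>Z\<close>. The degree rises by
  \<open>4 * e + 2\<close>, since \<open>W\<close> occurs squared and each factor costs
  \<open>2 * e + 1\<close>.\<close>

lemma step:
  assumes m: "m > 0" and U: "finite U" "3 * m ^ 4 * (card (excess Y U) + 1) \<le> card Y"
    and n: "e \<le> n" "n + (4 * e + 2) < k" and \<eta>: "0 \<le> \<eta>" "\<eta> \<le> 1 / 2"
    and \<phi>: "trig {g \<in> X n. h g \<in> U} \<phi>" "\<And>x. cmod (\<phi> x) \<le> 1"
  shows "\<exists>\<phi>' U'. finite U' \<and> card (excess Y U') + 1 \<le> 8 * m ^ 5 * (card (excess Y U) + 1) \<and>
    trig {g \<in> X (n + (4 * e + 2)). h g \<in> U'} \<phi>' \<and> (\<forall>x. cmod (\<phi>' x) \<le> 1) \<and>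
    (1 - \<eta>) * (1 - 1 / (4 * real m) + 1 / (16 * (real m)\<^sup>2)) * pairing B \<phi> + sqrt \<eta> / 2 * \<mu>
      \<le> pairing B \<phi>'"
proof -
  obtain a where a: "\<And>i. i < m \<Longrightarrow> a i \<in> Y" "\<And>u d. u \<in> U \<Longrightarrow> d \<in> gaps2 a m \<Longrightarrow> u + d \<notin> Y"
    "finite (shifted U a m)"
    "card (excess Y (shifted U a m)) + 1 \<le> 8 * m ^ 5 * (card (excess Y U) + 1)"
    using selection_step[OF finite_Y U(1) m U(2)] by metis
  define W where "W = (\<lambda>x. pair_sum (\<lambda>i. \<Phi> (a i) x) m)"
  define Z where "Z = (\<lambda>x. \<Sum>i<m. \<Phi> (a i) x)"
  define D where "D = {x - x' |x x'. x \<in> X e \<and> x' \<in> X e \<and> h x - h x' \<in> gaps a m}"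
  define n' where "n' = n + (4 * e + 2)"
  define P where "P = {g \<in> X n'. \<exists>u\<in>U. \<exists>d\<in>gaps2 a m. h g = u + d}"
  define U' where "U' = shifted U a m"
  have W: "trig D W"
    unfolding W_def pair_sum_def
  proof (intro trig_sum, rule trig_mult)
    fix j i assume ij: "j \<in> {..<m}" "i \<in> {..<j}"
    show "trig {g \<in> X e. h g = a i} (\<Phi> (a i))" using \<Phi>_trig a(1) ij by simp
    show "trig {g. - g \<in> X e \<and> h (- g) = a j} (\<lambda>x. cnj (\<Phi> (a j) x))"
      by (rule trig_cnj[OF \<Phi>_trig]) (use a(1) ij in auto)
    fix g g' assume g: "g \<in> {g \<in> X e. h g = a i}" "g' \<in> {g. - g \<in> X e \<and> h (- g) = a j}"
    have "g + g' = g - (- g')" by simp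
    moreover have "h g - h (- g') \<in> gaps a m" using g ij by (auto simp: gaps_def)
    ultimately show "g + g' \<in> D" using g unfolding D_def by blast
  qed
  have D_add: "g + d \<in> X (l + (2 * e + 1)) \<and> (\<exists>p\<in>gaps a m. h (g + d) = h g + p)"
    if g: "g \<in> X l" and d: "d \<in> D" for g d l
  proof -
    obtain x x' where x: "d = x - x'" "x \<in> X e" "x' \<in> X e" "h x - h x' \<in> gaps a m"
      using d by (auto simp: D_def)
    have "h d = h x - h x'" using h_add[of x "- x'"] h_uminus[of x'] x(1) by simp
    then show ?thesis using X_diff[OF g x(2,3)] x h_add by auto
  qed
  define P1 where "P1 = {g \<in> X (n + (2 * e + 1)). \<exists>u\<in>U. \<exists>p\<in>gaps a m. h g = u + p}"
  have \<phi>W: "trig P1 (\<lambda>x. \<phi> x * W x)"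
  proof (rule trig_mult[OF \<phi>(1) W])
    fix g d assume "g \<in> {g \<in> X n. h g \<in> U}" "d \<in> D"
    then show "g + d \<in> P1" using D_add[of g n d] by (auto simp: P1_def)
  qed
  have \<phi>WW: "trig P (\<lambda>x. \<phi> x * W x * W x)"
  proof (rule trig_mult[OF \<phi>W W])
    fix g d assume g: "g \<in> P1" "d \<in> D"
    then obtain u p where up: "u \<in> U" "p \<in> gaps a m" "h g = u + p" "g \<in> X (n + (2 * e + 1))"
      by (auto simp: P1_def)
    obtain q where q: "q \<in> gaps a m" "h (g + d) = u + (p + q)" and
        "g + d \<in> X (n + (2 * e + 1) + (2 * e + 1))"
      using D_add[OF up(4) g(2)] up(3) by auto
    moreover have "n + (2 * e + 1) + (2 * e + 1) = n'" by (simp add: n'_def)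
    moreover have "p + q \<in> gaps2 a m" using up(2) q(1) by (auto simp: gaps2_def)
    ultimately show "g + d \<in> P" using up(1) unfolding P_def by auto
  qed
  have "P1 \<subseteq> P"
    using X_mono[of "n + (2 * e + 1)" n'] by (auto simp: P1_def P_def n'_def gaps2_def)
  then have \<phi>W': "trig P (\<lambda>x. \<phi> x * W x)" using \<phi>W trig_mono by blast
  define M where "M = real m"
  define c0 where "c0 = 1 - 1 / (4 * M) + 1 / (16 * M\<^sup>2)"
  define c1 where "c1 = 1 / (4 * M ^ 3) - 1 / (2 * M\<^sup>2)"
  define c2 where "c2 = 1 / (4 * M ^ 4)"
  define \<kappa> where "\<kappa> = sqrt \<eta> / (2 * M)"
  define R where "R = (\<lambda>x. of_real c1 * (\<phi> x * W x) + of_real c2 * (\<phi> x * W x * W x))"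
  define \<phi>' where "\<phi>' = (\<lambda>x. of_real (1 - \<eta>) * (of_real c0 * \<phi> x + R x) + of_real \<kappa> * Z x)"
  have R: "trig P R" unfolding R_def by (intro trig.add trig_scale \<phi>W' \<phi>WW)
  \<comment> \<open>Frequencies in \<open>P\<close> have a coordinate \<open>u + d\<close> outside
    \<open>Y\<close>; as their degree is below \<open>k\<close>, \<open>in_Y\<close> keeps them out
    of \<open>B\<close>.\<close>
  have R0: "pairing B R = 0"
  proof (rule pairing_eq_0[OF finite_B R])
    fix g assume "g \<in> P"
    then have "g \<in> X n'" "h g \<notin> Y" using a(2) by (auto simp: P_def)
    then show "snd g \<notin> B" using in_Y[of g n'] n by (auto simp: n'_def)
  qed
  define Q where "Q = {g \<in> X n'. h g \<in> U'}"
  have "P \<subseteq> Q" unfolding P_def Q_def U'_def shifted_def by blast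
  then have RQ: "trig Q R" using R trig_mono by blast
  have "{g \<in> X n. h g \<in> U} \<subseteq> Q"
  proof -
    have "u \<in> U'" if "u \<in> U" for u
    proof -
      have "u = u + 0" by simp
      then show ?thesis using that unfolding U'_def shifted_def by blast
    qed
    then show ?thesis using X_mono[of n n'] by (auto simp: Q_def n'_def)
  qed
  then have \<phi>Q: "trig Q \<phi>" using \<phi>(1) trig_mono by blast
  have \<Phi>Q: "trig Q (\<Phi> (a i))" if "i < m" for i
  proof (rule trig_mono[OF \<Phi>_trig[OF a(1)[OF that]]])
    show "{g \<in> X e. h g = a i} \<subseteq> Q"
      using X_mono[of e n'] n that by (auto simp: Q_def n'_def U'_def shifted_def)
  qed
  have ZQ: "trig Q Z" unfolding Z_def by (intro trig_sum \<Phi>Q) simp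
  have \<phi>'Q: "trig Q \<phi>'" unfolding \<phi>'_def by (intro trig.add trig_scale \<phi>Q RQ ZQ)
  have norm: "cmod (\<phi>' x) \<le> 1" for x
  proof -
    have "\<phi> x * damping (\<lambda>i. \<Phi> (a i) x) m =
        \<phi> x * (of_real c0 + of_real c1 * W x + of_real c2 * (W x * W x))"
      unfolding damping_expand[OF m] W_def c0_def c1_def c2_def M_def ..
    also have "\<dots> = of_real c0 * \<phi> x + R x"
      unfolding R_def by (simp add: algebra_simps)
    finally have "of_real c0 * \<phi> x + R x = \<phi> x * damping (\<lambda>i. \<Phi> (a i) x) m" ..
    then show ?thesis
      unfolding \<phi>'_def \<kappa>_def M_def Z_def
      using norm_step_le[of m "\<lambda>i. \<Phi> (a i) x" "\<phi> x" \<eta>] m \<phi>(2) \<eta> \<Phi>_le[OF a(1)] by simp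
  qed
  have "pairing B Z = (\<Sum>i<m. pairing B (\<Phi> (a i)))"
    unfolding Z_def using \<Phi>Q by (intro pairing_sum) auto
  also have "\<dots> \<ge> (\<Sum>i<m. \<mu>)" using \<Phi>_pairing a(1) by (intro sum_mono) auto
  finally have Z: "M * \<mu> \<le> pairing B Z" by (simp add: M_def)
  have "pairing B \<phi>' = (1 - \<eta>) * (c0 * pairing B \<phi>) + \<kappa> * pairing B Z"
  proof -
    have "trig Q (\<lambda>x. of_real c0 * \<phi> x)" by (rule trig_scale[OF \<phi>Q])
    moreover have "trig Q (\<lambda>x. of_real (1 - \<eta>) * (of_real c0 * \<phi> x + R x))"
      by (intro trig_scale trig.add \<phi>Q RQ)
    moreover have "trig Q (\<lambda>x. of_real \<kappa> * Z x)" by (rule trig_scale[OF ZQ])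
    ultimately show ?thesis
      unfolding \<phi>'_def using R0 RQ by (simp only: pairing_add pairing_scale add_0_right)
  qed
  moreover have "sqrt \<eta> / 2 * \<mu> \<le> \<kappa> * pairing B Z"
  proof -
    have "sqrt \<eta> / 2 * \<mu> = \<kappa> * (M * \<mu>)" using m by (simp add: \<kappa>_def M_def)
    also have "\<dots> \<le> \<kappa> * pairing B Z" using Z \<eta> by (intro mult_left_mono) (auto simp: \<kappa>_def M_def)
    finally show ?thesis .
  qed
  ultimately have pair: "(1 - \<eta>) * c0 * pairing B \<phi> + sqrt \<eta> / 2 * \<mu> \<le> pairing B \<phi>'"
    by (simp add: mult.assoc)
  show ?thesis
  proof (intro exI conjI allI)
    show "finite U'" "card (excess Y U') + 1 \<le> 8 * m ^ 5 * (card (excess Y U) + 1)"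
      unfolding U'_def by (fact a(3), fact a(4))
    show "trig {g \<in> X (n + (4 * e + 2)). h g \<in> U'} \<phi>'"
      using \<phi>'Q unfolding Q_def n'_def .
    show "cmod (\<phi>' x) \<le> 1" for x by (rule norm)
    show "(1 - \<eta>) * (1 - 1 / (4 * real m) + 1 / (16 * (real m)\<^sup>2)) * pairing B \<phi> + sqrt \<eta> / 2 * \<mu>
        \<le> pairing B \<phi>'"
      using pair unfolding c0_def M_def .
  qed
qed

text \<open>With \<open>s = sqrt \<eta> / 2 * \<mu>\<close>, each step sends a bound
  \<open>a\<close> to \<open>q * a + s\<close>; as \<open>q \<le> 1\<close>, this yields
  \<open>t * q ^ t * s\<close>. \<open>card (excess Y U) + 1\<close> starts at 1 and gains at most a
  factor \<open>8 * N ^ 5\<close> per step, so the size condition is that of the last step.\<close>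

lemma iterate:
  assumes N: "N > 0" "3 * N ^ 4 * (8 * N ^ 5) ^ (N - 1) \<le> card Y" "e + N * (4 * e + 2) < k"
    and \<eta>: "0 \<le> \<eta>" "\<eta> \<le> 1 / 2"
    and q: "q = (1 - \<eta>) * (1 - 1 / (4 * real N) + 1 / (16 * (real N)\<^sup>2))" "0 \<le> q" "q \<le> 1"
    and t: "t \<le> N"
  shows "\<exists>\<phi> U. finite U \<and> card (excess Y U) + 1 \<le> (8 * N ^ 5) ^ t \<and>
    trig {g \<in> X (e + t * (4 * e + 2)). h g \<in> U} \<phi> \<and> (\<forall>x. cmod (\<phi> x) \<le> 1) \<and>
    real t * q ^ t * (sqrt \<eta> / 2 * \<mu>) \<le> pairing B \<phi>"
  using t
proof (induction t)
  case 0
  have "excess Y {} = {}" by (simp add: excess_def)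
  then show ?case
    by (intro exI[of _ "\<lambda>x. 0"] exI[of _ "{}"]) (auto simp: trig.zero pairing_def)
next
  case (Suc t)
  define n where "n = e + t * (4 * e + 2)"
  obtain \<phi> U where \<phi>: "finite U" "card (excess Y U) + 1 \<le> (8 * N ^ 5) ^ t"
      "trig {g \<in> X n. h g \<in> U} \<phi>" "\<And>x. cmod (\<phi> x) \<le> 1"
      "real t * q ^ t * (sqrt \<eta> / 2 * \<mu>) \<le> pairing B \<phi>"
    using Suc unfolding n_def by auto
  have "3 * N ^ 4 * (card (excess Y U) + 1) \<le> 3 * N ^ 4 * (8 * N ^ 5) ^ t"
    using \<phi>(2) by (rule mult_left_mono) simp
  also have "\<dots> \<le> 3 * N ^ 4 * (8 * N ^ 5) ^ (N - 1)"
    using Suc.prems N(1) by (intro mult_left_mono power_increasing) auto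
  also note N(2)
  finally have large: "3 * N ^ 4 * (card (excess Y U) + 1) \<le> card Y" .
  have nS: "n + (4 * e + 2) = e + Suc t * (4 * e + 2)" by (simp add: n_def)
  have "Suc t * (4 * e + 2) \<le> N * (4 * e + 2)" using Suc.prems by (rule mult_right_mono) simp
  then have nk: "n + (4 * e + 2) < k" using N(3) nS by linarith
  have en: "e \<le> n" by (simp add: n_def)
  obtain \<phi>' U' where \<phi>': "finite U'" "card (excess Y U') + 1 \<le> 8 * N ^ 5 * (card (excess Y U) + 1)"
      "trig {g \<in> X (n + (4 * e + 2)). h g \<in> U'} \<phi>'" "\<forall>x. cmod (\<phi>' x) \<le> 1"
      "q * pairing B \<phi> + sqrt \<eta> / 2 * \<mu> \<le> pairing B \<phi>'"
    using step[OF N(1) \<phi>(1) large en nk \<eta> \<phi>(3,4)] unfolding q(1) by blast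
  have "8 * N ^ 5 * (card (excess Y U) + 1) \<le> 8 * N ^ 5 * (8 * N ^ 5) ^ t"
    using \<phi>(2) by (rule mult_left_mono) simp
  then have "card (excess Y U') + 1 \<le> (8 * N ^ 5) ^ Suc t" using \<phi>'(2) by simp
  moreover have "real (Suc t) * q ^ Suc t * (sqrt \<eta> / 2 * \<mu>) \<le> pairing B \<phi>'"
  proof -
    define s where "s = sqrt \<eta> / 2 * \<mu>"
    have s: "0 \<le> s" using \<mu>_nonneg \<eta> by (simp add: s_def)
    have "real (Suc t) * q ^ Suc t * s = q * (real t * q ^ t * s) + q ^ Suc t * s"
      by (simp add: algebra_simps)
    also have "\<dots> \<le> q * pairing B \<phi> + 1 * s"
      using \<phi>(5) q s by (intro add_mono mult_left_mono mult_right_mono power_le_one) (auto simp: s_def)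
    finally show ?thesis using \<phi>'(5) by (simp add: s_def)
  qed
  ultimately show ?case
    using \<phi>'(1,3,4) unfolding nS by (intro exI[of _ \<phi>'] exI[of _ U'] conjI)
qed

text \<open>For \<open>\<eta> = 1 / (2 * N)\<close> each step keeps a factor of at least
  \<open>1 - 3 / (4 * N)\<close>, so by Bernoulli \<open>N\<close> steps lose at most a factor 4,
  against \<open>N\<close> gains of \<open>sqrt \<eta> / 2\<close>.\<close>

lemma level:
  assumes N: "N > 0" "3 * N ^ 4 * (8 * N ^ 5) ^ (N - 1) \<le> card Y" "e + N * (4 * e + 2) < k"
  shows "\<exists>\<phi>. trig (X (e + N * (4 * e + 2))) \<phi> \<and> (\<forall>x. cmod (\<phi> x) \<le> 1) \<and>
    sqrt (real N) / 12 * \<mu> \<le> pairing B \<phi>"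
proof -
  define M where "M = real N"
  define \<eta> where "\<eta> = 1 / (2 * M)"
  define q where "q = (1 - \<eta>) * (1 - 1 / (4 * M) + 1 / (16 * M\<^sup>2))"
  have M: "M \<ge> 1" using N(1) by (simp add: M_def)
  have \<eta>: "0 \<le> \<eta>" "\<eta> \<le> 1 / 2" using M by (auto simp: \<eta>_def field_simps)
  have b: "0 \<le> 1 / (4 * M)" "1 / (4 * M) \<le> 1 / 4" "0 \<le> 1 / (16 * M\<^sup>2)" "1 / (16 * M\<^sup>2) \<le> 1 / (4 * M)"
    using M by (auto simp: field_simps power2_eq_square)
  have q01: "0 \<le> q" "q \<le> 1"
    using \<eta> b unfolding q_def by (auto intro!: mult_nonneg_nonneg mult_le_one)
  have "1 - 3 / (4 * M) \<le> (1 - \<eta>) * (1 - 1 / (4 * M))"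
    using M by (simp add: \<eta>_def field_simps)
  also have "\<dots> \<le> q" unfolding q_def using \<eta> b by (intro mult_left_mono) auto
  finally have q_ge: "1 - 3 / (4 * M) \<le> q" .
  have "1 / 4 = 1 + real N * (- (3 / (4 * M)))" using M by (simp add: M_def)
  also have "\<dots> \<le> (1 + (- (3 / (4 * M)))) ^ N"
    using M by (intro Bernoulli_inequality) (simp add: field_simps)
  also have "\<dots> \<le> q ^ N" using q_ge M by (intro power_mono) (auto simp: field_simps)
  finally have qN: "1 / 4 \<le> q ^ N" .
  obtain \<phi> U where \<phi>: "trig {g \<in> X (e + N * (4 * e + 2)). h g \<in> U} \<phi>" "\<forall>x. cmod (\<phi> x) \<le> 1"
      "M * q ^ N * (sqrt \<eta> / 2 * \<mu>) \<le> pairing B \<phi>"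
    using iterate[OF N \<eta> q_def[unfolded M_def] q01 order_refl] unfolding M_def by blast
  have "sqrt M / 12 \<le> M * (1 / 4) * (sqrt \<eta> / 2)"
  proof -
    \<comment> \<open>The gain is \<open>sqrt M / (8 * sqrt 2)\<close>; this bound makes it
      \<open>sqrt M / 12\<close>.\<close>
    have "sqrt 2 \<le> 3 / 2" by (rule real_le_lsqrt) (auto simp: power2_eq_square)
    then have "1 / (3 / 2) \<le> 1 / sqrt 2" by (intro divide_left_mono) auto
    moreover have eq: "M * (1 / 4) * (sqrt \<eta> / 2) = sqrt M * (1 / sqrt 2) / 8"
      using M by (simp add: \<eta>_def real_sqrt_divide real_sqrt_mult field_simps)
    ultimately have "sqrt M * (1 / (3 / 2)) \<le> sqrt M * (1 / sqrt 2)"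
      using M by (intro mult_left_mono) auto
    then have "sqrt M * (1 / (3 / 2)) / 8 \<le> sqrt M * (1 / sqrt 2) / 8"
      by (rule divide_right_mono) simp
    then show ?thesis unfolding eq by simp
  qed
  also have "\<dots> \<le> M * q ^ N * (sqrt \<eta> / 2)"
    using qN M \<eta> by (intro mult_right_mono mult_left_mono) auto
  finally have "sqrt M / 12 * \<mu> \<le> M * q ^ N * (sqrt \<eta> / 2) * \<mu>"
    using \<mu>_nonneg by (rule mult_right_mono)
  also have "\<dots> \<le> pairing B \<phi>" using \<phi>(3) by (simp add: mult.assoc)
  finally have "sqrt (real N) / 12 * \<mu> \<le> pairing B \<phi>" by (simp add: M_def)
  moreover have "trig (X (e + N * (4 * e + 2))) \<phi>" by (rule trig_mono[OF \<phi>(1)]) auto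
  ultimately show ?thesis using \<phi>(2) by blast
qed

end

section \<open>Words of bounded degree in a group\<close>

definition words :: "'g::ab_group_add set \<Rightarrow> nat \<Rightarrow> 'g set"
  where "words G n = {sum_list xs - sum_list ys |xs ys.
    set xs \<subseteq> G \<and> set ys \<subseteq> G \<and> length xs = Suc n \<and> length ys = n}"

lemma wordsI: "set xs \<subseteq> G \<Longrightarrow> set ys \<subseteq> G \<Longrightarrow> length xs = Suc n \<Longrightarrow> length ys = n \<Longrightarrow>
    g = sum_list xs - sum_list ys \<Longrightarrow> g \<in> words G n"
  unfolding words_def by blast

lemma wordsE:
  assumes "g \<in> words G n"
  obtains xs ys where "set xs \<subseteq> G" "set ys \<subseteq> G" "length xs = Suc n" "length ys = n"
    "g = sum_list xs - sum_list ys"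
  using assms unfolding words_def by blast

lemma subset_words_0: "G \<subseteq> words G 0"
proof
  fix g assume "g \<in> G"
  then show "g \<in> words G 0" by (intro wordsI[of "[g]" G "[]"]) auto
qed

text \<open>One point, repeated, is appended to both lists; \<open>xs\<close> is never empty, so its
  head is available.\<close>

lemma words_mono:
  assumes "n \<le> n'"
  shows "words G n \<subseteq> words G n'"
proof
  fix g assume "g \<in> words G n"
  then obtain xs ys where w: "set xs \<subseteq> G" "set ys \<subseteq> G" "length xs = Suc n" "length ys = n"
    "g = sum_list xs - sum_list ys" by (rule wordsE)
  define p where "p = replicate (n' - n) (hd xs)"
  have "hd xs \<in> G" using w by (cases xs) auto
  then show "g \<in> words G n'"
    using w assms by (intro wordsI[of "xs @ p" G "ys @ p"]) (auto simp: p_def)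
qed

text \<open>\<open>x\<close> brings \<open>e + 1\<close> points with plus and \<open>e\<close> with
  minus, \<open>x'\<close> the reverse: \<open>2 * e + 1\<close> more on either side.\<close>

lemma words_diff:
  assumes "g \<in> words G n" "x \<in> words G e" "x' \<in> words G e"
  shows "g + (x - x') \<in> words G (n + (2 * e + 1))"
proof -
  obtain a b where g: "set a \<subseteq> G" "set b \<subseteq> G" "length a = Suc n" "length b = n"
    "g = sum_list a - sum_list b" using assms(1) by (rule wordsE)
  obtain c d where x: "set c \<subseteq> G" "set d \<subseteq> G" "length c = Suc e" "length d = e"
    "x = sum_list c - sum_list d" using assms(2) by (rule wordsE)
  obtain c' d' where x': "set c' \<subseteq> G" "set d' \<subseteq> G" "length c' = Suc e" "length d' = e"
    "x' = sum_list c' - sum_list d'" using assms(3) by (rule wordsE)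
  show ?thesis
    using g x x' by (intro wordsI[of "a @ c @ d'" G "b @ d @ c'"]) auto
qed

subsection \<open>Freiman isomorphisms\<close>

lemma sum_nth_append:
  fixes f :: "'a \<Rightarrow> 'b::comm_monoid_add"
  assumes "length xs = k" "length ys = k"
  shows "(\<Sum>m=1..k. f ((xs @ ys) ! (m - 1))) = sum_list (map f xs)"
    and "(\<Sum>m=k+1..2*k. f ((xs @ ys) ! (m - 1))) = sum_list (map f ys)"
proof -
  have list: "sum_list (map f zs) = (\<Sum>m<length zs. f (zs ! m))" for zs
    by (simp add: sum_list_sum_nth atLeast0LessThan)
  have *: "(\<Sum>m=1..k. g m) = (\<Sum>m<k. g (Suc m))" for g :: "nat \<Rightarrow> 'b"
    using sum.atLeast1_atMost_eq[of g k] by simp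
  show "(\<Sum>m=1..k. f ((xs @ ys) ! (m - 1))) = sum_list (map f xs)"
    unfolding * list using assms by (intro sum.cong) (auto simp: nth_append)
  have "(\<Sum>m=k+1..2*k. f ((xs @ ys) ! (m - 1))) = (\<Sum>m=1..k. f ((xs @ ys) ! (m + k - 1)))"
    using sum.shift_bounds_cl_nat_ivl[of "\<lambda>m. f ((xs @ ys) ! (m - 1))" 1 k k]
    by (simp add: mult_2)
  then show "(\<Sum>m=k+1..2*k. f ((xs @ ys) ! (m - 1))) = sum_list (map f ys)"
    unfolding * list using assms by (simp add: nth_append)
qed

lemma freiman_iso_sum_list:
  fixes \<theta> :: "'a::ab_group_add \<Rightarrow> 'b::ab_group_add"
  assumes iso: "freiman_iso k \<theta> A B" and xs: "set xs \<subseteq> A" "length xs = k"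
    and ys: "set ys \<subseteq> A" "length ys = k"
    and eq: "sum_list (map \<theta> xs) = sum_list (map \<theta> ys)"
  shows "sum_list xs = sum_list ys"
proof -
  define a where "a = (\<lambda>m. (xs @ ys) ! (m - 1))"
  have "\<forall>m\<in>{1..2*k}. a m \<in> A"
  proof
    fix m assume "m \<in> {1..2*k}"
    then have "m - 1 < length (xs @ ys)" using xs ys by auto
    then have "a m \<in> set (xs @ ys)" unfolding a_def by (rule nth_mem)
    then show "a m \<in> A" using xs ys by auto
  qed
  then have "(\<Sum>m=1..k. a m) = (\<Sum>m=k+1..2*k. a m) \<longleftrightarrow>
      (\<Sum>m=1..k. \<theta> (a m)) = (\<Sum>m=k+1..2*k. \<theta> (a m))"
    using iso unfolding freiman_iso_def by blast
  then show ?thesis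
    using eq sum_nth_append[OF xs(2) ys(2), of "\<lambda>x. x"] sum_nth_append[OF xs(2) ys(2), of \<theta>]
    unfolding a_def by simp
qed

text \<open>A word in the graph carries a combination of points of \<open>A\<close> together with
  the same combination of their images, although \<open>\<theta>\<close> need not be
  additive.\<close>

definition graph_of :: "('a \<Rightarrow> 'b) \<Rightarrow> 'a set \<Rightarrow> ('a \<times> 'b) set"
  where "graph_of \<theta> A = (\<lambda>a. (a, \<theta> a)) ` A"

text \<open>If \<open>snd g = \<theta> a\<close>, moving the negative points across equates two sums
  of \<open>n + 1\<close> images. Padded with copies of \<open>a\<close> to length \<open>k\<close>,
  the equality transfers back and gives \<open>fst g = a\<close>.\<close>

lemma freiman_iso_words:
  fixes \<theta> :: "'a::ab_group_add \<Rightarrow> 'b::ab_group_add"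
  assumes iso: "freiman_iso k \<theta> A B" and g: "g \<in> words (graph_of \<theta> A) n" "n < k" "snd g \<in> B"
  shows "fst g \<in> A"
proof -
  obtain xs ys where w: "set xs \<subseteq> graph_of \<theta> A" "set ys \<subseteq> graph_of \<theta> A" "length xs = Suc n"
      "length ys = n" "g = sum_list xs - sum_list ys"
    using g(1) by (rule wordsE)
  have "snd g \<in> \<theta> ` A" using iso g(3) by (simp add: freiman_iso_def bij_betw_def)
  then obtain a where a: "a \<in> A" "snd g = \<theta> a" by blast
  \<comment> \<open>The subtraction does not truncate, because \<open>n < k\<close>.\<close>
  define p where "p = replicate (k - Suc n) a"
  have sums: "sum_list (map fst zs) = fst (sum_list zs)" "sum_list (map snd zs) = snd (sum_list zs)"
    for zs :: "('a \<times> 'b) list"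
    by (induction zs) auto
  have snd_graph: "map \<theta> (map fst zs) = map snd zs" if "set zs \<subseteq> graph_of \<theta> A" for zs
    using that by (auto simp: graph_of_def)
  have "sum_list (map \<theta> (map fst xs @ p)) = sum_list (map \<theta> (map fst ys @ [a] @ p))"
  proof -
    have "snd (sum_list xs) = snd (sum_list ys) + \<theta> a"
      using a(2) w(5) by (simp add: algebra_simps)
    then show ?thesis
      using snd_graph[OF w(1)] snd_graph[OF w(2)] by (simp only: map_append sum_list_append) (simp add: sums)
  qed
  then have "sum_list (map fst xs @ p) = sum_list (map fst ys @ [a] @ p)"
    using w g(2) a(1)
    by (intro freiman_iso_sum_list[OF iso]) (auto simp: p_def graph_of_def)
  then have "fst g = a" using w(5) by (simp add: sums)
  then show ?thesis using a(1) by simp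
qed

section \<open>Rows, planes and the whole set\<close>

definition threshold :: "nat \<Rightarrow> nat"
  where "threshold N = 3 * N ^ 4 * (8 * N ^ 5) ^ (N - 1)"

text \<open>Degree of the function that \<open>level\<close> makes from blocks of degree
  \<open>e\<close>; \<open>threshold\<close> is the number of positions it asks for.\<close>

definition next_degree :: "nat \<Rightarrow> nat \<Rightarrow> nat"
  where "next_degree N e = e + N * (4 * e + 2)"

text \<open>\<open>level\<close> is applied three times: in rows along \<open>j\<close> with single
  exponentials as blocks, in planes along \<open>l\<close> with the row functions, and in
  \<open>A\<close> along \<open>i\<close> with the plane functions.\<close>

lemma L1_norm_ge_sqrt:
  fixes A :: "(int ^ 3) set" and i j l :: 3
  assumes iso: "freiman_iso k \<theta> A B" and "finite A"
    and N: "P > 0" "R > 0" "S > 0"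
    and p: "threshold P \<le> card ((\<lambda>x. x $ i) ` A)"
    and r: "\<And>u. {x \<in> A. x $ i = u} \<noteq> {} \<Longrightarrow> threshold R \<le> card ((\<lambda>x. x $ l) ` {x \<in> A. x $ i = u})"
    and s: "\<And>u v. {x \<in> A. x $ i = u \<and> x $ l = v} \<noteq> {} \<Longrightarrow>
      threshold S \<le> card ((\<lambda>x. x $ j) ` {x \<in> A. x $ i = u \<and> x $ l = v})"
    and k: "next_degree P (next_degree R (next_degree S 0)) < k"
  shows "sqrt (real P) / 12 * (sqrt (real R) / 12 * (sqrt (real S) / 12)) \<le> L1_norm_exp_sum B"
proof -
  define G where "G = graph_of \<theta> A"
  define e1 where "e1 = next_degree S 0"
  define e2 where "e2 = next_degree R e1"
  have e: "e1 \<le> e2" "e2 < k" using k by (auto simp: e1_def e2_def next_degree_def)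
  have B: "B = \<theta> ` A" using iso by (simp add: freiman_iso_def bij_betw_def)
  have finB: "finite B" using B assms(2) by simp
  have inA: "fst g \<in> A" if "g \<in> words G n" "n < k" "snd g \<in> B" for g n
    using freiman_iso_words[OF iso] that unfolding G_def by blast
  have wm: "g \<in> words G n'" if "g \<in> words G n" "n \<le> n'" for g n n'
    using words_mono that by blast
  have row: "\<exists>\<phi>. trig {g \<in> words G e1. fst g $ i = u \<and> fst g $ l = v} \<phi> \<and>
      (\<forall>x. cmod (\<phi> x) \<le> 1) \<and> sqrt (real S) / 12 * 1 \<le> pairing B \<phi>"
    if ne: "{x \<in> A. x $ i = u \<and> x $ l = v} \<noteq> {}" for u v
  proof -
    define T where "T = {x \<in> A. x $ i = u \<and> x $ l = v}"
    define Y where "Y = (\<lambda>x. x $ j) ` T"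
    have "\<forall>y\<in>Y. \<exists>x\<in>T. x $ j = y" unfolding Y_def by blast
    then obtain pt where pt: "\<And>y. y \<in> Y \<Longrightarrow> pt y \<in> T" "\<And>y. y \<in> Y \<Longrightarrow> pt y $ j = y" by metis
    \<comment> \<open>Single exponentials have degree 0 and pairing 1. Fixing the coordinates
      \<open>i\<close> and \<open>l\<close> is compatible with \<open>X_diff\<close>, since
      \<open>g + (x - x')\<close> preserves them.\<close>
    interpret test_family "\<lambda>n. {g \<in> words G n. fst g $ i = u \<and> fst g $ l = v}" "\<lambda>g. fst g $ j"
      B Y k 0 1 "\<lambda>y. wave (\<theta> (pt y))"
    proof
      show "trig {g \<in> {g \<in> words G 0. fst g $ i = u \<and> fst g $ l = v}. fst g $ j = y} (wave (\<theta> (pt y)))"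
        if "y \<in> Y" for y
      proof -
        have "(pt y, \<theta> (pt y)) \<in> words G 0"
          using pt(1)[OF that] subset_words_0[of G] by (auto simp: G_def graph_of_def T_def)
        then show ?thesis
          using trig_single[of "(pt y, \<theta> (pt y))"] pt[OF that] by (simp add: T_def)
      qed
      show "1 \<le> pairing B (wave (\<theta> (pt y)))" if "y \<in> Y" for y
        using pt(1)[OF that] by (simp add: pairing_wave[OF finB]) (simp add: T_def B)
    next
      fix g n assume "g \<in> {g \<in> words G n. fst g $ i = u \<and> fst g $ l = v}" "n < k" "snd g \<in> B"
      then show "fst g $ j \<in> Y" using inA[of g n] by (auto simp: Y_def T_def)
    next
      show "{g \<in> words G n. fst g $ i = u \<and> fst g $ l = v} \<subseteq> {g \<in> words G n'. fst g $ i = u \<and> fst g $ l = v}"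
        if "n \<le> n'" for n n' using wm[OF _ that] by blast
      show "g + (x - x') \<in> {g \<in> words G (n + (2 * 0 + 1)). fst g $ i = u \<and> fst g $ l = v}"
        if "g \<in> {g \<in> words G n. fst g $ i = u \<and> fst g $ l = v}"
          "x \<in> {g \<in> words G 0. fst g $ i = u \<and> fst g $ l = v}"
          "x' \<in> {g \<in> words G 0. fst g $ i = u \<and> fst g $ l = v}" for g x x' n
        using words_diff[of g G n x 0 x'] that by simp
      show "finite Y" using assms(2) by (simp add: Y_def T_def)
    qed (use finB in simp_all)
    show ?thesis
      using level[OF N(3)] s[OF ne] e unfolding Y_def T_def threshold_def e1_def next_degree_def by simp
  qed
  have plane: "\<exists>\<phi>. trig {g \<in> words G e2. fst g $ i = u} \<phi> \<and>
      (\<forall>x. cmod (\<phi> x) \<le> 1) \<and> sqrt (real R) / 12 * (sqrt (real S) / 12 * 1) \<le> pairing B \<phi>"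
    if ne: "{x \<in> A. x $ i = u} \<noteq> {}" for u
  proof -
    define Y where "Y = (\<lambda>x. x $ l) ` {x \<in> A. x $ i = u}"
    have "\<forall>v\<in>Y. \<exists>\<phi>. trig {g \<in> words G e1. fst g $ i = u \<and> fst g $ l = v} \<phi> \<and>
      (\<forall>x. cmod (\<phi> x) \<le> 1) \<and> sqrt (real S) / 12 * 1 \<le> pairing B \<phi>"
      unfolding Y_def by (intro ballI row) auto
    from bchoice[OF this] obtain \<Phi> where
      "\<forall>v\<in>Y. trig {g \<in> words G e1. fst g $ i = u \<and> fst g $ l = v} (\<Phi> v) \<and>
        (\<forall>x. cmod (\<Phi> v x) \<le> 1) \<and> sqrt (real S) / 12 * 1 \<le> pairing B (\<Phi> v)"
      by (rule exE)
    note \<Phi> = this[THEN bspec, THEN conjunct1]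
      this[THEN bspec, THEN conjunct2, THEN conjunct1, THEN spec]
      this[THEN bspec, THEN conjunct2, THEN conjunct2]
    interpret test_family "\<lambda>n. {g \<in> words G n. fst g $ i = u}" "\<lambda>g. fst g $ l"
      B Y k e1 "sqrt (real S) / 12 * 1" \<Phi>
    proof
      show "trig {g \<in> {g \<in> words G e1. fst g $ i = u}. fst g $ l = y} (\<Phi> y)" if "y \<in> Y" for y
        using \<Phi>(1)[OF that] by (simp add: conj_assoc)
    next
      fix g n assume "g \<in> {g \<in> words G n. fst g $ i = u}" "n < k" "snd g \<in> B"
      then show "fst g $ l \<in> Y" using inA[of g n] by (auto simp: Y_def)
    next
      show "{g \<in> words G n. fst g $ i = u} \<subseteq> {g \<in> words G n'. fst g $ i = u}"
        if "n \<le> n'" for n n' using wm[OF _ that] by blast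
      show "g + (x - x') \<in> {g \<in> words G (n + (2 * e1 + 1)). fst g $ i = u}"
        if "g \<in> {g \<in> words G n. fst g $ i = u}" "x \<in> {g \<in> words G e1. fst g $ i = u}"
          "x' \<in> {g \<in> words G e1. fst g $ i = u}" for g x x' n
        using words_diff[of g G n x e1 x'] that by simp
      show "finite Y" using assms(2) by (simp add: Y_def)
    qed (use finB \<Phi>(2,3) in simp_all)
    show ?thesis
      using level[OF N(2)] r[OF ne] e unfolding Y_def threshold_def e2_def next_degree_def by simp
  qed
  define Y where "Y = (\<lambda>x. x $ i) ` A"
  have "\<forall>u\<in>Y. \<exists>\<phi>. trig {g \<in> words G e2. fst g $ i = u} \<phi> \<and>
      (\<forall>x. cmod (\<phi> x) \<le> 1) \<and> sqrt (real R) / 12 * (sqrt (real S) / 12 * 1) \<le> pairing B \<phi>"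
    unfolding Y_def by (intro ballI plane) auto
  from bchoice[OF this] obtain \<Phi> where
    "\<forall>u\<in>Y. trig {g \<in> words G e2. fst g $ i = u} (\<Phi> u) \<and>
      (\<forall>x. cmod (\<Phi> u x) \<le> 1) \<and> sqrt (real R) / 12 * (sqrt (real S) / 12 * 1) \<le> pairing B (\<Phi> u)"
    by (rule exE)
  note \<Phi> = this[THEN bspec, THEN conjunct1]
    this[THEN bspec, THEN conjunct2, THEN conjunct1, THEN spec]
    this[THEN bspec, THEN conjunct2, THEN conjunct2]
  interpret test_family "words G" "\<lambda>g. fst g $ i"
    B Y k e2 "sqrt (real R) / 12 * (sqrt (real S) / 12 * 1)" \<Phi>
  proof
    fix g n assume "g \<in> words G n" "n < k" "snd g \<in> B"
    then show "fst g $ i \<in> Y" using inA[of g n] by (auto simp: Y_def)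
  next
    show "finite Y" using assms(2) by (simp add: Y_def)
  qed (use finB \<Phi> in \<open>simp_all add: words_mono words_diff del: One_nat_def add_Suc_right\<close>)
  obtain \<phi> where \<phi>: "trig (words G (next_degree P e2)) \<phi>" "\<And>x. cmod (\<phi> x) \<le> 1"
      "sqrt (real P) / 12 * (sqrt (real R) / 12 * (sqrt (real S) / 12 * 1)) \<le> pairing B \<phi>"
  proof -
    have "e2 + P * (4 * e2 + 2) < k" using k by (simp add: e2_def e1_def next_degree_def)
    from level[OF N(1) p[folded Y_def, unfolded threshold_def] this] that show thesis
      unfolding next_degree_def by blast
  qed
  then show ?thesis using pairing_le_L1[OF \<phi>(1,2), of B] by simp
qed

subsection \<open>The theorem\<close>

lemma next_degree_le:
  assumes "P > 0" "R > 0" "S > 0"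
  shows "2 * next_degree P (next_degree R (next_degree S 0)) + 1 \<le> 125 * (P * R * S)"
proof -
  \<comment> \<open>In terms of \<open>2 * e + 1\<close> the affine recursion is multiplication by
    \<open>4 * N + 1\<close>, starting from 1.\<close>
  have eq: "2 * next_degree N e + 1 = (4 * N + 1) * (2 * e + 1)" for N e
    by (simp add: next_degree_def algebra_simps)
  have le: "4 * N + 1 \<le> 5 * N" if "N > 0" for N :: nat using that by simp
  have "2 * next_degree P (next_degree R (next_degree S 0)) + 1 = (4 * P + 1) * ((4 * R + 1) * (4 * S + 1))"
    unfolding eq by simp
  also have "\<dots> \<le> 5 * P * (5 * R * (5 * S))"
    using assms by (intro mult_mono le) auto
  finally show ?thesis by (simp add: mult_ac)
qed

text \<open>A constant above 1 makes the iterated logarithms positive and bridges the gap between 62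
  and \<open>125 / 2\<close>: \<open>125 / (2 * (26 / 25) ^ 3) < 56\<close>.\<close>

lemma ln_3_ge: "26 / 25 \<le> ln (3 :: real)"
proof -
  \<comment> \<open>Eight such factors make \<open>exp (26 / 25)\<close>; at this small argument the
    quadratic bound is sharp enough.\<close>
  have "exp (13 / 100) \<le> 1 + 13 / 100 + (13 / 100 :: real)\<^sup>2"
    by (rule exp_bound) auto
  then have "exp (13 / 100) ^ 8 \<le> (1 + 13 / 100 + (13 / 100 :: real)\<^sup>2) ^ 8"
    by (rule power_mono) simp
  also have "\<dots> \<le> 3" by (simp add: power2_eq_square field_simps)
  finally have "exp (26 / 25) \<le> (3 :: real)"
    by (simp flip: exp_of_nat_mult)
  then show ?thesis by (subst ln_ge_iff) auto
qed

lemma ln_nat_ge: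
  assumes "x \<ge> (3::nat)"
  shows "26 / 25 \<le> ln (real x)"
proof -
  have "ln 3 \<le> ln (real x)" using assms by simp
  then show ?thesis using ln_3_ge by linarith
qed

text \<open>For \<open>N > 1\<close>, \<open>threshold N \<le> (8 * N ^ 5) ^ N\<close>, whose
  logarithm is \<open>N * (ln 8 + 5 * ln N)\<close>, so \<open>N\<close> may be of order
  \<open>L / ln L\<close> with \<open>L = ln x\<close>. The upper bound on \<open>N\<close> serves
  to control degrees.\<close>

lemma threshold_le:
  assumes "x \<ge> 3"
  shows "\<exists>N>0. threshold N \<le> x \<and> real N \<le> ln (real x) / (26 / 25) \<and>
    ln (real x) / (28 * ln (ln (real x))) \<le> real N"
proof -
  define L where "L = ln (real x)"
  have L: "26 / 25 \<le> L" using ln_nat_ge[OF assms] by (simp add: L_def)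
  have lnL: "ln L > 0" using L by simp
  show ?thesis
  proof (cases "L \<le> 28 * ln L")
    \<comment> \<open>The lower bound asked for is at most 1, and \<open>N = 1\<close> works because
      \<open>threshold 1 = 3\<close>.\<close>
    case True
    then have "L / (28 * ln L) \<le> 1" using lnL by simp
    then show ?thesis
      using L assms unfolding L_def by (intro exI[of _ 1]) (auto simp: threshold_def)
  next
    case False
    \<comment> \<open>For \<open>26 / 25 \<le> L \<le> 26\<close> one has
      \<open>L^2 \<le> (26 + 26 / 25) * (L - 1)\<close>, hence
      \<open>L \<le> 28 * (1 - 1 / L) \<le> 28 * ln L\<close>, against the case assumption.\<close>
    have L26: "L > 26"
    proof (rule ccontr)
      assume "\<not> L > 26"
      then have "(L - 26 / 25) * (26 - L) \<ge> 0" using L by (intro mult_nonneg_nonneg) auto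
      moreover have "(L - 26 / 25) * (26 - L) = 26 * L - L * L - 676 / 25 + 26 / 25 * L"
        by (simp add: field_simps)
      ultimately have "L * L \<le> 28 * (L - 1)" using L unfolding right_diff_distrib by linarith
      then have "L \<le> 28 * (1 - 1 / L)" using L by (simp add: field_simps)
      moreover have "1 - 1 / L \<le> ln L"
        using ln_le_minus_one[of "1 / L"] L by (simp add: ln_div)
      ultimately show False using False by simp
    qed
    have lnL1: "ln L \<ge> 1"
      using exp_le L26 by (subst ln_ge_iff) auto
    \<comment> \<open>As \<open>M \<ge> 2\<close>, its floor is at least \<open>M / 2\<close>, which
      turns 14 into 28.\<close>
    define M where "M = L / (14 * ln L)"
    define N where "N = nat \<lfloor>M\<rfloor>"
    have M: "M \<ge> 2" using False lnL by (simp add: M_def field_simps)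
    have N: "real N \<le> M" "M < real N + 1" "N \<ge> 2"
      using M by (auto simp: N_def le_nat_iff le_floor_iff)
    have "M \<le> L / 14" unfolding M_def using lnL1 L26 by (intro divide_left_mono) auto
    then have NL: "real N \<le> L / 14" using N by simp
    have "ln (real ((8 * N ^ 5) ^ N)) = real N * (ln 8 + 5 * ln (real N))"
      using N(3) by (simp add: ln_realpow ln_mult distrib_left)
    \<comment> \<open>The right side is \<open>8 / 14 * L\<close>, safely below
      \<open>L\<close>.\<close>
    also have "\<dots> \<le> M * (3 * ln L + 5 * ln L)"
    proof (intro mult_mono add_mono mult_left_mono)
      have "ln (8::real) = 3 * ln 2" using ln_realpow[of 2 3] by simp
      then show "ln 8 \<le> 3 * ln L" using ln_2_less_1 lnL1 by simp
      show "ln (real N) \<le> ln L" using N(3) NL L26 by simp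
    qed (use N M lnL1 in auto)
    also have "\<dots> \<le> L" using lnL L26 by (simp add: M_def)
    finally have "real ((8 * N ^ 5) ^ N) \<le> real x"
      using N(3) assms unfolding L_def by (subst (asm) ln_le_cancel_iff) auto
    then have "(8 * N ^ 5) ^ N \<le> x" by (simp only: of_nat_le_iff)
    moreover have "threshold N \<le> (8 * N ^ 5) ^ N"
    proof -
      have "N ^ 4 \<le> N ^ 5" using N(3) by (intro power_increasing) auto
      then have "3 * N ^ 4 \<le> 8 * N ^ 5" by linarith
      then have "threshold N \<le> 8 * N ^ 5 * (8 * N ^ 5) ^ (N - 1)"
        unfolding threshold_def by (rule mult_right_mono) simp
      also have "\<dots> = (8 * N ^ 5) ^ N" using N(3) by (cases N) auto
      finally show ?thesis .
    qed
    moreover have "L / (28 * ln L) \<le> real N"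
      using N M by (simp add: M_def)
    moreover have "real N \<le> L / (26 / 25)" using NL L26 by simp
    ultimately show ?thesis using N(3) unfolding L_def by (intro exI[of _ N]) auto
  qed
qed

section \<open>Counting slices and rows by coordinates\<close>

lemma planar_slices_card_le:
  assumes "finite A"
  shows "card (planar_slices A i - {{}}) \<le> card ((\<lambda>x. x $ i) ` A)"
proof (rule surj_card_le)
  show "planar_slices A i - {{}} \<subseteq> (\<lambda>a. A \<inter> {x. x $ i = a}) ` (\<lambda>x. x $ i) ` A"
    by (auto simp: planar_slices_def)
qed (use assms in simp)

text \<open>Inside a plane orthogonal to axis \<open>i\<close>, a non-empty row in direction
  \<open>j\<close> is determined by its coordinate \<open>l\<close>.\<close>

lemma axis_rows_card_le:
  fixes A :: "(int ^ 3) set" and i j l :: 3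
  assumes "finite A" and UNIV: "\<And>t. t = i \<or> t = j \<or> t = l" "i \<noteq> j" "l \<noteq> j"
  shows "card (axis_rows {x \<in> A. x $ i = u} j - {{}}) \<le> card ((\<lambda>x. x $ l) ` {x \<in> A. x $ i = u})"
proof (rule surj_card_le)
  let ?S = "{x \<in> A. x $ i = u}"
  show "axis_rows ?S j - {{}} \<subseteq> (\<lambda>v. {x \<in> ?S. x $ l = v}) ` (\<lambda>x. x $ l) ` ?S"
  proof
    fix R assume "R \<in> axis_rows ?S j - {{}}"
    then obtain a x where R: "R = ?S \<inter> {x. \<forall>t. t \<noteq> j \<longrightarrow> x $ t = a t}" and x: "x \<in> R"
      by (auto simp: axis_rows_def)
    have "R = {y \<in> ?S. y $ l = x $ l}"
    proof (intro set_eqI iffI)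
      fix y assume "y \<in> R"
      then show "y \<in> {y \<in> ?S. y $ l = x $ l}" using R x UNIV(3) by auto
    next
      fix y assume y: "y \<in> {y \<in> ?S. y $ l = x $ l}"
      have "y $ t = a t" if "t \<noteq> j" for t
        using UNIV(1)[of t] that x y unfolding R by (elim disjE) auto
      then show "y \<in> R" using y R by auto
    qed
    then show "R \<in> (\<lambda>v. {x \<in> ?S. x $ l = v}) ` (\<lambda>x. x $ l) ` ?S" using x R by blast
  qed
qed (use assms(1) in simp)

theorem theorem1p3:
  shows "\<exists>c :: real. c > 0 \<and>
    (\<forall>(p :: nat) (r :: nat) (s :: nat) (k :: nat) (A :: (int ^ 3) set) (B :: int set).
      p \<ge> 3 \<longrightarrow> r \<ge> 3 \<longrightarrow> s \<ge> 3 \<longrightarrow> finite A \<longrightarrow>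
      (\<exists>i j :: 3. i \<noteq> j \<and>
        card (planar_slices A i - {{}}) \<ge> p \<and>
        (\<forall>S \<in> planar_slices A i - {{}}. card (axis_rows S j - {{}}) \<ge> r) \<and>
        (\<forall>R \<in> axis_rows A j - {{}}. card R \<ge> s)) \<longrightarrow>
      real k \<ge> 62 * ln (real r) * ln (real s) * ln (real p) \<longrightarrow>
      freiman_isomorphic k A B \<longrightarrow>
      L1_norm_exp_sum B \<ge>
        c * sqrt ((ln (real s) * ln (real r) * ln (real p)) /
                  (ln (ln (real s)) * ln (ln (real r)) * ln (ln (real p)))))"
\<comment> \<open>1728 is \<open>12 ^ 3\<close>, one factor 12 per level; each 28 comes from
  \<open>threshold_le\<close>.\<close>
proof (intro exI[of _ "1 / (1728 * sqrt (28 ^ 3))"] conjI allI impI)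
  fix p r s k :: nat and A :: "(int ^ 3) set" and B :: "int set"
  assume prs: "p \<ge> 3" "r \<ge> 3" "s \<ge> 3" and finA: "finite A"
    and "\<exists>i j :: 3. i \<noteq> j \<and> card (planar_slices A i - {{}}) \<ge> p \<and>
        (\<forall>S \<in> planar_slices A i - {{}}. card (axis_rows S j - {{}}) \<ge> r) \<and>
        (\<forall>R \<in> axis_rows A j - {{}}. card R \<ge> s)"
    and k: "real k \<ge> 62 * ln (real r) * ln (real s) * ln (real p)"
    and "freiman_isomorphic k A B"
  then obtain i j :: 3 and \<theta> where ij: "i \<noteq> j"
    and p: "card (planar_slices A i - {{}}) \<ge> p"
    and r: "\<And>S. S \<in> planar_slices A i - {{}} \<Longrightarrow> card (axis_rows S j - {{}}) \<ge> r"
    and s: "\<And>R. R \<in> axis_rows A j - {{}} \<Longrightarrow> card R \<ge> s"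
    and iso: "freiman_iso k \<theta> A B"
    unfolding freiman_isomorphic_def by blast
  have "\<exists>l. l \<noteq> i \<and> l \<noteq> j \<and> (\<forall>t. t = i \<or> t = j \<or> t = l)"
    using ij exhaust_3[of i] exhaust_3[of j] unfolding forall_3 by auto
  then obtain l where l: "l \<noteq> i" "l \<noteq> j" "\<And>t. t = i \<or> t = j \<or> t = l" by blast
  define Lp Lr Ls where "Lp = ln (real p)" and "Lr = ln (real r)" and "Ls = ln (real s)"
  obtain P where P: "P > 0" "threshold P \<le> p" "real P \<le> Lp / (26 / 25)" "Lp / (28 * ln Lp) \<le> real P"
    using threshold_le[OF prs(1)] unfolding Lp_def by blast
  obtain R where R: "R > 0" "threshold R \<le> r" "real R \<le> Lr / (26 / 25)" "Lr / (28 * ln Lr) \<le> real R"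
    using threshold_le[OF prs(2)] unfolding Lr_def by blast
  obtain S where S: "S > 0" "threshold S \<le> s" "real S \<le> Ls / (26 / 25)" "Ls / (28 * ln Ls) \<le> real S"
    using threshold_le[OF prs(3)] unfolding Ls_def by blast
  have L: "Lp \<ge> 26 / 25" "Lr \<ge> 26 / 25" "Ls \<ge> 26 / 25"
    using ln_nat_ge prs by (simp_all add: Lp_def Lr_def Ls_def)
  have "sqrt (real P) / 12 * (sqrt (real R) / 12 * (sqrt (real S) / 12)) \<le> L1_norm_exp_sum B"
  proof (rule L1_norm_ge_sqrt[OF iso finA P(1) R(1) S(1)])
    show "threshold P \<le> card ((\<lambda>x. x $ i) ` A)"
      using P(2) p planar_slices_card_le[OF finA, of i] by linarith
    show "threshold R \<le> card ((\<lambda>x. x $ l) ` {x \<in> A. x $ i = u})" if "{x \<in> A. x $ i = u} \<noteq> {}" for u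
    proof -
      have "{x \<in> A. x $ i = u} = A \<inter> {x. x $ i = u}" by blast
      then have "{x \<in> A. x $ i = u} \<in> planar_slices A i - {{}}"
        using that unfolding planar_slices_def by blast
      from r[OF this] show ?thesis
        using R(2) axis_rows_card_le[OF finA l(3) ij l(2), of u] by linarith
    qed
    show "threshold S \<le> card ((\<lambda>x. x $ j) ` {x \<in> A. x $ i = u \<and> x $ l = v})"
      if "{x \<in> A. x $ i = u \<and> x $ l = v} \<noteq> {}" for u v
    proof -
      let ?R = "{x \<in> A. x $ i = u \<and> x $ l = v}"
      define a where "a = (\<lambda>t. if t = i then u else v)"
      have "(\<forall>t. t \<noteq> j \<longrightarrow> x $ t = a t) \<longleftrightarrow> x $ i = u \<and> x $ l = v" for x :: "int ^ 3"
        using l ij unfolding a_def by metis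
      then have "?R = A \<inter> {x. \<forall>t. t \<noteq> j \<longrightarrow> x $ t = a t}" by blast
      then have "?R \<in> axis_rows A j - {{}}"
        using that unfolding axis_rows_def by blast
      from s[OF this] have "threshold S \<le> card ?R" using S(2) by linarith
      \<comment> \<open>Points of a row differ in coordinate \<open>j\<close> alone.\<close>
      also have "\<dots> = card ((\<lambda>x. x $ j) ` ?R)"
      proof (rule card_image[symmetric], rule inj_onI)
        fix x y assume "x \<in> ?R" "y \<in> ?R" "x $ j = y $ j"
        then have "x $ t = y $ t" for t using l(3)[of t] by auto
        then show "x = y" by (simp add: vec_eq_iff)
      qed
      finally show ?thesis .
    qed
    \<comment> \<open>The final degree is less than half of \<open>125 * (P * R * S)\<close>, hence
      below \<open>56 * Lr * Ls * Lp\<close>, which the hypothesis on \<open>k\<close>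
      covers.\<close>
    have "real P * real R * real S \<le> Lp / (26 / 25) * (Lr / (26 / 25)) * (Ls / (26 / 25))"
      using P R S L by (intro mult_mono) auto
    moreover have "2 * real (next_degree P (next_degree R (next_degree S 0))) + 1
        \<le> 125 * (real P * real R * real S)"
      using next_degree_le[OF P(1) R(1) S(1)] by (simp flip: of_nat_mult of_nat_le_iff[where 'a = real])
    moreover have "0 \<le> Lr * Ls * Lp" using L by simp
    ultimately have "real (next_degree P (next_degree R (next_degree S 0))) < 62 * Lr * Ls * Lp"
      by (simp add: mult_ac)
    then show "next_degree P (next_degree R (next_degree S 0)) < k"
      using k unfolding Lp_def Lr_def Ls_def by linarith
  qed
  moreover have "1 / (1728 * sqrt (28 ^ 3)) * sqrt (Ls * Lr * Lp / (ln Ls * ln Lr * ln Lp))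
      \<le> sqrt (real P) / 12 * (sqrt (real R) / 12 * (sqrt (real S) / 12))"
  proof -
    have "Ls * Lr * Lp / (ln Ls * ln Lr * ln Lp) / 28 ^ 3 =
        Lp / (28 * ln Lp) * (Lr / (28 * ln Lr)) * (Ls / (28 * ln Ls))"
      by (simp add: field_simps)
    also have "\<dots> \<le> real P * real R * real S"
      using P R S L by (intro mult_mono) auto
    finally have "sqrt (Ls * Lr * Lp / (ln Ls * ln Lr * ln Lp) / 28 ^ 3) \<le> sqrt (real P * real R * real S)"
      by (rule real_sqrt_le_mono)
    then show ?thesis by (simp add: real_sqrt_divide real_sqrt_mult mult_ac)
  qed
  ultimately show "L1_norm_exp_sum B \<ge> 1 / (1728 * sqrt (28 ^ 3)) *
      sqrt ((ln (real s) * ln (real r) * ln (real p)) /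
        (ln (ln (real s)) * ln (ln (real r)) * ln (ln (real p))))"
    unfolding Lp_def Lr_def Ls_def by linarith
qed simp

end
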